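(* Let $G,\psi,x_c$ be as in the context, let $\ell\ge 0$ be an integer, let $x_i\in(0,x_c)$, and let $$0\le\kappa<\min\Big\{1,\frac{1-x_c^2G'(x_c)}{2}\Big\}.$$ Then there are positive constants $C_1,C_2$, depending only on $G,\psi,\ell$ (with $\kappa$ and $x_i$ fixed), such that the following holds. Let $f,g\in C_0^\infty(\mathbb{R})$ and let $\tilde\phi\in C^\infty([x_i,x_c)\times\mathbb{R})$ be the unique solution of the wave equation $(W_\kappa)$ of the context with $\tilde\phi|_{x=x_i}=f$, $\tilde\phi_{,x}|_{x=x_i}=g$. Then $$E[\tilde\phi](x)\le C_1\,\hat E(f,g),\qquad x\in[x_i,x_c].$$ In particular, $\tilde\phi$ has finite $H^{1,2}$ norm at the Cauchy horizon: $$\int_{\mathbb{R}}\tilde\phi^2(x_c,\rho)+\tilde\phi_{,\rho}^2(x_c,\rho)\,d\rho\le C_2\,\hat E(f,g)<\infty .$$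
   Context: Background. A spherically symmetric self-similar spacetime has line element $ds^2=-2Ge^{\psi}dv^2+2e^{\psi}dv\,dr+r^2d\Omega^2$ with $G=G(x)$, $\psi=\psi(x)$, $x=v/r$; put $\rho=\ln r$. Standing assumptions: there is a smallest positive root $x_c$ of $xG(x)-1=0$ (the Cauchy horizon is $x=x_c$); $G,\psi$ are real-analytic on $(-\infty,x_c]$; $x\psi'\le 0$ and $G'-\psi'(1-xG)G\le 0$ (null energy condition); $G>0$ on $(-\infty,x_c]$; $G'<0$ on $(0,x_c)$; $G'(x_c)<0$; and $1+x_c^2G'(x_c)>0$. Primes on functions of $x$ alone denote $d/dx$; commas denote partial derivatives. Equation. Put $\alpha(x)=-2x(1-xG)$, $\beta(x)=1-2xG$, $\gamma(x)=2G$ (so $\alpha<0$ on $(0,x_c)$ and $\alpha(x_c)=0$). If $\phi(x,\rho)$ is the $(\ell,m)$ spherical-harmonic multipole of a minimally coupled massless scalar field on this background, then $\tilde\phi=e^{\kappa\rho}\phi$ satisfies $$(W_\kappa)\quad \alpha\tilde\phi_{,xx}+2\beta\tilde\phi_{,x\rho}+\gamma\tilde\phi_{,\rho\rho}+(\alpha'+2(1-\kappa)\beta)\tilde\phi_{,x}+(\beta'+2(1-\kappa)\gamma)\tilde\phi_{,\rho}+\big[(\kappa^2-2\kappa)\gamma-\kappa\beta'-\ell(\ell+1)e^{\psi}\big]\tilde\phi=0 .$$ For $f,g\in C_0^\infty(\mathbb{R})$ (smooth, compactly supported) and $x_i\in(0,x_c)$, the initial value problem for $(W_\kappa)$ with $\tilde\phi|_{x=x_i}=f$,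 $\tilde\phi_{,x}|_{x=x_i}=g$ has a unique solution in $C^\infty([x_i,x_c)\times\mathbb{R})$, and $\tilde\phi(x,\cdot)$ has compact support for each $x\in[x_i,x_c)$ (standard theory of linear symmetric hyperbolic systems). Energies. $$E[\tilde\phi](x)=\int_{\mathbb{R}}\big(-\alpha\tilde\phi_{,x}^2+\gamma\tilde\phi_{,\rho}^2+H\tilde\phi^2\big)(x,\rho)\,d\rho,\qquad H=\ell(\ell+1)e^{\psi}-(\kappa^2-2\kappa)\gamma+\kappa\beta',$$ $$\hat E(f,g)=\int_{\mathbb{R}} f^2+\big(\alpha(x_i)g+\beta(x_i)f'\big)^2+(f')^2\,d\rho .$$ Quantities at $x=x_c$ (such as $E[\tilde\phi](x_c)$, $\tilde\phi(x_c,\rho)$) are understood as limits $x\to x_c^-$. *)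

theory Defs
  imports "HOL-Analysis.Analysis"
begin

text \<open>Analyticity on a set means a convergent power series in a full real neighbourhood of each of
  its points, as for the library's analytic_on. At the endpoint of a half-line this says that the
  function continues analytically beyond the endpoint, so the two-sided derivatives
  used below are meaningful there.\<close>

definition real_analytic_on :: "(real \<Rightarrow> real) \<Rightarrow> real set \<Rightarrow> bool" where
  "real_analytic_on f S \<longleftrightarrow>
     (\<forall>a\<in>S. \<exists>r>0. \<exists>c. \<forall>x. \<bar>x - a\<bar> < r \<longrightarrow> (\<lambda>n. c n * (x - a) ^ n) sums f x)"

definition test_function :: "(real \<Rightarrow> real) \<Rightarrow> bool" where
  "test_function f \<longleftrightarrow>
     (\<forall>n x. (deriv ^^ n) f differentiable at x) \<and> compact (closure (support_on UNIV f))"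

text \<open>Functions of $(x,\rho)$ are curried and are considered on a strip
  $I \times \mathbb{R}$; the $x$-derivative is taken within $I$, hence one-sided at an endpoint
  belonging to $I$.\<close>

definition partial_x :: "real set \<Rightarrow> (real \<Rightarrow> real \<Rightarrow> real) \<Rightarrow> real \<Rightarrow> real \<Rightarrow> real" where
  "partial_x I u x \<rho> = vector_derivative (\<lambda>s. u s \<rho>) (at x within I)"

definition partial_rho :: "(real \<Rightarrow> real \<Rightarrow> real) \<Rightarrow> real \<Rightarrow> real \<Rightarrow> real" where
  "partial_rho u x \<rho> = deriv (u x) \<rho>"

primrec Ck_on_strip :: "nat \<Rightarrow> real set \<Rightarrow> (real \<Rightarrow> real \<Rightarrow> real) \<Rightarrow> bool" where
  "Ck_on_strip 0 I u \<longleftrightarrow> continuous_on (I \<times> UNIV) (\<lambda>(x, \<rho>). u x \<rho>)"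
| "Ck_on_strip (Suc k) I u \<longleftrightarrow>
     continuous_on (I \<times> UNIV) (\<lambda>(x, \<rho>). u x \<rho>) \<and>
     (\<forall>x\<in>I. \<forall>\<rho>. (\<lambda>s. u s \<rho>) differentiable (at x within I) \<and> u x differentiable (at \<rho>)) \<and>
     Ck_on_strip k I (partial_x I u) \<and> Ck_on_strip k I (partial_rho u)"

definition smooth_on_strip :: "real set \<Rightarrow> (real \<Rightarrow> real \<Rightarrow> real) \<Rightarrow> bool" where
  "smooth_on_strip I u \<longleftrightarrow> (\<forall>k. Ck_on_strip k I u)"

text \<open>The metric functions \<open>G\<close>, \<open>\<psi>\<close> live on $(-\infty,x_c]$; values of the total
  functions outside a neighbourhood of that half-line are irrelevant.\<close>

definition self_similar_background :: "(real \<Rightarrow> real) \<Rightarrow> (real \<Rightarrow> real) \<Rightarrow> real \<Rightarrow> bool" where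
  "self_similar_background G \<psi> xc \<longleftrightarrow>
     0 < xc \<and> xc * G xc - 1 = 0 \<and> (\<forall>x. 0 < x \<and> x < xc \<longrightarrow> x * G x - 1 \<noteq> 0) \<and>
     real_analytic_on G {..xc} \<and> real_analytic_on \<psi> {..xc} \<and>
     (\<forall>x\<le>xc. x * deriv \<psi> x \<le> 0) \<and>
     (\<forall>x\<le>xc. deriv G x - deriv \<psi> x * (1 - x * G x) * G x \<le> 0) \<and>
     (\<forall>x\<le>xc. G x > 0) \<and>
     (\<forall>x\<in>{0<..<xc}. deriv G x < 0) \<and>
     deriv G xc < 0 \<and>
     1 + xc\<^sup>2 * deriv G xc > 0"

definition \<alpha> :: "(real \<Rightarrow> real) \<Rightarrow> real \<Rightarrow> real" where
  "\<alpha> G x = - 2 * x * (1 - x * G x)"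

definition \<beta> :: "(real \<Rightarrow> real) \<Rightarrow> real \<Rightarrow> real" where
  "\<beta> G x = 1 - 2 * x * G x"

definition \<gamma> :: "(real \<Rightarrow> real) \<Rightarrow> real \<Rightarrow> real" where
  "\<gamma> G x = 2 * G x"

definition wave_operator ::
  "(real \<Rightarrow> real) \<Rightarrow> (real \<Rightarrow> real) \<Rightarrow> nat \<Rightarrow> real \<Rightarrow> real set \<Rightarrow> (real \<Rightarrow> real \<Rightarrow> real) \<Rightarrow> real \<Rightarrow> real \<Rightarrow> real"
where
  "wave_operator G \<psi> l \<kappa> I u x \<rho> =
     \<alpha> G x * partial_x I (partial_x I u) x \<rho>
     + 2 * \<beta> G x * partial_rho (partial_x I u) x \<rho>
     + \<gamma> G x * partial_rho (partial_rho u) x \<rho>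
     + (deriv (\<alpha> G) x + 2 * (1 - \<kappa>) * \<beta> G x) * partial_x I u x \<rho>
     + (deriv (\<beta> G) x + 2 * (1 - \<kappa>) * \<gamma> G x) * partial_rho u x \<rho>
     + ((\<kappa>\<^sup>2 - 2 * \<kappa>) * \<gamma> G x - \<kappa> * deriv (\<beta> G) x - real l * (real l + 1) * exp (\<psi> x)) * u x \<rho>"

definition wave_solution ::
  "(real \<Rightarrow> real) \<Rightarrow> (real \<Rightarrow> real) \<Rightarrow> nat \<Rightarrow> real \<Rightarrow> real \<Rightarrow> real
     \<Rightarrow> (real \<Rightarrow> real) \<Rightarrow> (real \<Rightarrow> real) \<Rightarrow> (real \<Rightarrow> real \<Rightarrow> real) \<Rightarrow> bool"
where
  "wave_solution G \<psi> l \<kappa> xc xi f g u \<longleftrightarrow>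
     smooth_on_strip {xi..<xc} u \<and>
     (\<forall>x\<in>{xi..<xc}. \<forall>\<rho>. wave_operator G \<psi> l \<kappa> {xi..<xc} u x \<rho> = 0) \<and>
     (\<forall>\<rho>. u xi \<rho> = f \<rho>) \<and>
     (\<forall>\<rho>. partial_x {xi..<xc} u xi \<rho> = g \<rho>)"

definition energy_potential :: "(real \<Rightarrow> real) \<Rightarrow> (real \<Rightarrow> real) \<Rightarrow> nat \<Rightarrow> real \<Rightarrow> real \<Rightarrow> real" where
  "energy_potential G \<psi> l \<kappa> x =
     real l * (real l + 1) * exp (\<psi> x) - (\<kappa>\<^sup>2 - 2 * \<kappa>) * \<gamma> G x + \<kappa> * deriv (\<beta> G) x"

definition energy_density ::
  "(real \<Rightarrow> real) \<Rightarrow> (real \<Rightarrow> real) \<Rightarrow> nat \<Rightarrow> real \<Rightarrow> real set \<Rightarrow> (real \<Rightarrow> real \<Rightarrow> real) \<Rightarrow> real \<Rightarrow> real \<Rightarrow> real"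
where
  "energy_density G \<psi> l \<kappa> I u x \<rho> =
     - \<alpha> G x * (partial_x I u x \<rho>)\<^sup>2 + \<gamma> G x * (partial_rho u x \<rho>)\<^sup>2
     + energy_potential G \<psi> l \<kappa> x * (u x \<rho>)\<^sup>2"

definition energy ::
  "(real \<Rightarrow> real) \<Rightarrow> (real \<Rightarrow> real) \<Rightarrow> nat \<Rightarrow> real \<Rightarrow> real set \<Rightarrow> (real \<Rightarrow> real \<Rightarrow> real) \<Rightarrow> real \<Rightarrow> real"
where
  "energy G \<psi> l \<kappa> I u x = (LINT \<rho>|lborel. energy_density G \<psi> l \<kappa> I u x \<rho>)"

definition data_density ::
  "(real \<Rightarrow> real) \<Rightarrow> real \<Rightarrow> (real \<Rightarrow> real) \<Rightarrow> (real \<Rightarrow> real) \<Rightarrow> real \<Rightarrow> real"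
where
  "data_density G xi f g \<rho> =
     (f \<rho>)\<^sup>2 + (\<alpha> G xi * g \<rho> + \<beta> G xi * deriv f \<rho>)\<^sup>2 + (deriv f \<rho>)\<^sup>2"

definition data_energy ::
  "(real \<Rightarrow> real) \<Rightarrow> real \<Rightarrow> (real \<Rightarrow> real) \<Rightarrow> (real \<Rightarrow> real) \<Rightarrow> real"
where
  "data_energy G xi f g = (LINT \<rho>|lborel. data_density G xi f g \<rho>)"

end

theory Submission
  imports Defs
begin

text \<open>Write the equation as \<open>a u\<^sub>x\<^sub>x + 2 b u\<^sub>x\<^sub>\<rho> + c u\<^sub>\<rho>\<^sub>\<rho> + p u\<^sub>x + q u\<^sub>\<rho> - h u = 0\<close> with \<open>a < 0\<close>
  vanishing only at \<open>x\<^sub>c\<close>. The \<open>x\<close>-derivative of the energy is the integral of a quadratic form in which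
  \<open>u\<^sub>x\<^sup>2\<close> has coefficient \<open>2 p - a'\<close>; the condition on \<open>\<kappa>\<close> says exactly that this is negative at
  \<open>x\<^sub>c\<close>, where the energy no longer controls \<open>u\<^sub>x\<close>. Adding \<open>\<lambda> \<integral> u\<^sup>2\<close> with \<open>\<lambda> > 0\<close> therefore gives an energy
  whose logarithmic growth rate is bounded up to \<open>x\<^sub>c\<close>. Since the equation does not depend on \<open>\<rho>\<close>, the same holds
  for \<open>u\<^sub>\<rho>\<close> and \<open>u\<^sub>\<rho>\<^sub>\<rho>\<close>. As \<open>- a\<close> is at least a multiple of \<open>x\<^sub>c - x\<close>, a Sobolev inequality in \<open>\<rho>\<close> bounds
  \<open>u\<^sub>x\<close> and \<open>u\<^sub>x\<^sub>\<rho>\<close> by multiples of the integrable function \<open>(x\<^sub>c - x)\<^sup>-\<^sup>1\<^sup>/\<^sup>2\<close>, so \<open>u\<close> and \<open>u\<^sub>\<rho>\<close> converge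
  uniformly, and Fatou's lemma bounds the limits.\<close>

subsection \<open>Calculus on the line\<close>

text \<open>At interior points of the interval the derivative within \<open>S\<close> is two-sided
  and the mean value argument applies; at the end points continuity is enough. This serves strips on
  whose closed end only one-sided derivatives exist.\<close>

lemma nonincreasing_from_within_derivative:
  fixes f f' :: "real \<Rightarrow> real"
  assumes "x1 \<le> x2" and sub: "{x1..x2} \<subseteq> S"
    and der: "\<And>x. x \<in> {x1..x2} \<Longrightarrow> (f has_real_derivative f' x) (at x within S)"
    and neg: "\<And>x. x \<in> {x1<..<x2} \<Longrightarrow> f' x \<le> 0"
  shows "f x2 \<le> f x1"
proof (rule DERIV_nonpos_imp_decreasing_open[OF \<open>x1 \<le> x2\<close>])
  have der': "(f has_real_derivative f' x) (at x within {x1..x2})" if "x \<in> {x1..x2}" for x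
    using has_field_derivative_subset[OF der[OF that] sub] .
  show "continuous_on {x1..x2} f"
    using der' by (meson DERIV_continuous_on)
  fix x assume x: "x1 < x" "x < x2"
  then have "(f has_real_derivative f' x) (at x)"
    using der'[of x] by (simp add: at_within_Icc_at)
  with neg[of x] x show "\<exists>y. (f has_real_derivative y) (at x) \<and> y \<le> 0" by auto
qed

text \<open>The limit is the infimum over \<open>{a..<b}\<close>, which explains both inequalities
  for \<open>L\<close>.\<close>

lemma antimono_bounded_below_tendsto_at_left:
  fixes f :: "real \<Rightarrow> real"
  assumes "a < b"
    and mono: "\<And>x y. a \<le> x \<Longrightarrow> x \<le> y \<Longrightarrow> y < b \<Longrightarrow> f y \<le> f x"
    and bnd: "\<And>x. a \<le> x \<Longrightarrow> x < b \<Longrightarrow> m \<le> f x"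
  obtains L where "(f \<longlongrightarrow> L) (at_left b)" "\<And>x. a \<le> x \<Longrightarrow> x < b \<Longrightarrow> L \<le> f x" "m \<le> L"
proof -
  define L where "L = (INF x\<in>{a..<b}. f x)"
  have bdd: "bdd_below (f ` {a..<b})"
    using bnd by (auto intro!: bdd_belowI[of _ m])
  have ne: "{a..<b} \<noteq> {}" using \<open>a < b\<close> by auto
  have le: "L \<le> f x" if "a \<le> x" "x < b" for x
    unfolding L_def using bdd that by (auto intro!: cINF_lower)
  have "m \<le> L" unfolding L_def using ne bnd by (auto intro!: cINF_greatest)
  moreover have "(f \<longlongrightarrow> L) (at_left b)"
  proof (rule decreasing_tendsto)
    show "\<forall>\<^sub>F x in at_left b. L \<le> f x"
      using eventually_at_left_real[OF \<open>a < b\<close>] by eventually_elim (use le in auto)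
    fix y assume "L < y"
    then obtain x where x: "x \<in> {a..<b}" "f x < y"
      unfolding L_def using cINF_less_iff[OF ne bdd] by auto
    then have "x < b" by simp
    show "\<forall>\<^sub>F x in at_left b. f x < y"
      by (rule eventually_mono[OF eventually_at_left_real[OF \<open>x < b\<close>]])
        (use x in \<open>auto intro!: le_less_trans[OF mono[of x]]\<close>)
  qed
  ultimately show thesis using that le by blast
qed

section \<open>Passage to the limit and integrals over the line\<close>

text \<open>Fatou's lemma for nonnegative integrals first yields finiteness, so integrability of the
  limit comes out as a conclusion, with the bound \<open>B\<close> in place of a dominating
  function.\<close>

lemma Fatou_bounded_integrals:
  fixes f :: "nat \<Rightarrow> 'a \<Rightarrow> real"
  assumes int: "\<And>n. integrable M (f n)" and nonneg: "\<And>n x. 0 \<le> f n x"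
    and lim: "\<And>x. (\<lambda>n. f n x) \<longlonglongrightarrow> g x"
    and bnd: "\<And>n. integral\<^sup>L M (f n) \<le> B"
  shows "integrable M g" and "integral\<^sup>L M g \<le> B"
proof -
  have [measurable]: "f n \<in> borel_measurable M" for n using int by auto
  have [measurable]: "g \<in> borel_measurable M"
    by (rule borel_measurable_LIMSEQ_real[of M f]) (use lim in auto)
  have g0: "0 \<le> g x" for x
    using LIMSEQ_le_const[OF lim] nonneg by blast
  have "0 \<le> integral\<^sup>L M (f 0)" using nonneg by simp
  then have B: "0 \<le> B" using bnd[of 0] by linarith
  have "(\<integral>\<^sup>+x. ennreal (g x) \<partial>M) = (\<integral>\<^sup>+x. liminf (\<lambda>n. ennreal (f n x)) \<partial>M)"
  proof (rule nn_integral_cong)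
    fix x
    have "(\<lambda>n. ennreal (f n x)) \<longlonglongrightarrow> ennreal (g x)" using lim by (rule tendsto_ennrealI)
    then show "ennreal (g x) = liminf (\<lambda>n. ennreal (f n x))"
      by (simp add: lim_imp_Liminf)
  qed
  also have "\<dots> \<le> liminf (\<lambda>n. \<integral>\<^sup>+x. ennreal (f n x) \<partial>M)"
    by (rule nn_integral_liminf) simp
  also have "\<dots> \<le> liminf (\<lambda>n. ennreal B)"
  proof (rule Liminf_mono, rule always_eventually, rule allI)
    fix n
    have "(\<integral>\<^sup>+x. ennreal (f n x) \<partial>M) = ennreal (integral\<^sup>L M (f n))"
      using int nonneg by (simp add: nn_integral_eq_integral)
    then show "(\<integral>\<^sup>+x. ennreal (f n x) \<partial>M) \<le> ennreal B"
      using bnd by (simp add: ennreal_leI)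
  qed
  also have "\<dots> = ennreal B" by (simp add: Liminf_const)
  finally have le: "(\<integral>\<^sup>+x. ennreal (g x) \<partial>M) \<le> ennreal B" .
  then show "integrable M g"
    by (intro integrableI_nonneg) (use g0 in \<open>auto simp: top.extremum_strict intro: le_less_trans\<close>)
  then have "(\<integral>\<^sup>+x. ennreal (g x) \<partial>M) = ennreal (integral\<^sup>L M g)"
    using g0 by (simp add: nn_integral_eq_integral)
  with le show "integral\<^sup>L M g \<le> B" using B by simp
qed

text \<open>Links the Henstock-Kurzweil integral, in which the fundamental theorem of calculus and
  differentiation under the integral are applied, with the Lebesgue integral of the
  energies.\<close>

lemma integral_Icc_le_lborel:
  fixes h k :: "real \<Rightarrow> real"
  assumes "continuous_on {a..b} h" "integrable lborel k"
    and "\<And>x. x \<in> {a..b} \<Longrightarrow> h x \<le> k x" "\<And>x. 0 \<le> k x"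
  shows "integral {a..b} h \<le> integral\<^sup>L lborel k"
proof -
  have i: "set_integrable lborel {a..b} h"
    using assms(1) by (rule borel_integrable_atLeastAtMost')
  have "integral {a..b} h = (LINT x:{a..b}|lborel. h x)"
    using set_borel_integral_eq_integral(2)[OF i] by simp
  also have "\<dots> \<le> integral\<^sup>L lborel k"
    unfolding set_lebesgue_integral_def
    by (rule integral_mono) (use i assms in \<open>auto simp: set_integrable_def indicator_def\<close>)
  finally show ?thesis .
qed

lemma integrable_continuous_vanishing_outside:
  fixes h :: "real \<Rightarrow> real"
  assumes "continuous_on {a..b} h" and "\<And>x. x \<notin> {a..b} \<Longrightarrow> h x = 0"
  shows "integrable lborel h" and "integral\<^sup>L lborel h = integral {a..b} h"
proof -
  have i: "set_integrable lborel {a..b} h"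
    using assms(1) by (rule borel_integrable_atLeastAtMost')
  have eq: "(\<lambda>x. indicator {a..b} x *\<^sub>R h x) = h"
    using assms(2) by (fastforce simp: indicator_def)
  show "integrable lborel h" using i unfolding set_integrable_def eq .
  show "integral\<^sup>L lborel h = integral {a..b} h"
    using set_borel_integral_eq_integral(2)[OF i] unfolding set_lebesgue_integral_def eq .
qed

text \<open>Integrating the derivative of \<open>(\<sigma> - y - 1) (h \<sigma>)\<^sup>2\<close> over \<open>[y, y + 1]\<close> gives \<open>(h y)\<^sup>2\<close>.\<close>

lemma sobolev_sup_bound:
  fixes h h' :: "real \<Rightarrow> real"
  assumes der: "\<And>x. (h has_real_derivative h' x) (at x)"
    and cont: "continuous_on UNIV h'"
    and int: "integrable lborel (\<lambda>x. (h x)\<^sup>2)" "integrable lborel (\<lambda>x. (h' x)\<^sup>2)"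
  shows "(h y)\<^sup>2 \<le> 2 * (LINT x|lborel. (h x)\<^sup>2) + (LINT x|lborel. (h' x)\<^sup>2)"
proof -
  define k where "k s = (h s)\<^sup>2 + 2 * (s - y - 1) * h s * h' s" for s
  have conth: "continuous_on S h" for S
    using der by (meson DERIV_continuous_on has_field_derivative_at_within)
  have conth': "continuous_on S h'" for S using cont continuous_on_subset by blast
  have "((\<lambda>s. (s - y - 1) * (h s)\<^sup>2) has_real_derivative k s) (at s)" for s
    unfolding k_def by (auto intro!: derivative_eq_intros der simp: power2_eq_square algebra_simps)
  then have "(k has_integral (((y + 1) - y - 1) * (h (y + 1))\<^sup>2 - (y - y - 1) * (h y)\<^sup>2)) {y..y+1}"
    by (intro fundamental_theorem_of_calculus)
      (auto simp: has_real_derivative_iff_has_vector_derivative[symmetric]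
        intro: has_field_derivative_at_within)
  then have "(h y)\<^sup>2 = integral {y..y+1} k" by (simp add: integral_unique)
  also have "\<dots> \<le> (LINT x|lborel. 2 * (h x)\<^sup>2 + (h' x)\<^sup>2)"
  proof (rule integral_Icc_le_lborel)
    show "continuous_on {y..y+1} k" unfolding k_def by (intro continuous_intros conth conth')
    show "integrable lborel (\<lambda>x. 2 * (h x)\<^sup>2 + (h' x)\<^sup>2)" using int by auto
    fix s assume s: "s \<in> {y..y+1}"
    \<comment> \<open>The weight is at most 1 in modulus on \<open>{y..y+1}\<close>, so Young's
      inequality costs one further \<open>(h s)\<^sup>2\<close>; hence the factor 2 in the
      result.\<close>
    have "2 * (s - y - 1) * h s * h' s \<le> (s - y - 1)\<^sup>2 * (h s)\<^sup>2 + (h' s)\<^sup>2"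
      using sum_squares_bound[of "(s - y - 1) * h s" "h' s"] by (simp only: power_mult_distrib mult.assoc)
    moreover have "\<bar>s - y - 1\<bar> \<le> 1" using s by auto
    then have "(s - y - 1)\<^sup>2 * (h s)\<^sup>2 \<le> 1 * (h s)\<^sup>2"
      by (intro mult_right_mono) (auto simp: abs_square_le_1)
    ultimately show "k s \<le> 2 * (h s)\<^sup>2 + (h' s)\<^sup>2" unfolding k_def by linarith
  qed auto
  also have "\<dots> = 2 * (LINT x|lborel. (h x)\<^sup>2) + (LINT x|lborel. (h' x)\<^sup>2)"
    using int by simp
  finally show ?thesis .
qed

section \<open>Bounds for continuous functions on a compact interval\<close>

lemma continuous_on_Icc_bound:
  fixes f :: "real \<Rightarrow> real"
  assumes "continuous_on {a..b} f"
  obtains K where "K > 0" "\<And>x. x \<in> {a..b} \<Longrightarrow> \<bar>f x\<bar> \<le> K"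
proof -
  have "bounded (f ` {a..b})"
    using compact_continuous_image[OF assms] compact_imp_bounded by auto
  then obtain K where "K > 0" "\<forall>x\<in>f ` {a..b}. norm x \<le> K" using bounded_pos by blast
  then show thesis using that by auto
qed

lemma continuous_on_Icc_pos_lower_bound:
  fixes f :: "real \<Rightarrow> real"
  assumes "continuous_on {a..b} f" and "\<And>x. x \<in> {a..b} \<Longrightarrow> 0 < f x"
  obtains k where "k > 0" "\<And>x. x \<in> {a..b} \<Longrightarrow> k \<le> f x"
proof (cases "a \<le> b")
  case True
  then obtain y where "y \<in> {a..b}" "\<forall>x\<in>{a..b}. f y \<le> f x"
    using continuous_attains_inf[of "{a..b}" f] assms(1) by auto
  then show thesis using that[of "f y"] assms(2) by auto
next
  case False
  then show thesis using that[of 1] by auto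
qed

text \<open>Near \<open>b\<close> continuity keeps \<open>p\<close> below a negative constant; away
  from \<open>b\<close> the function \<open>q\<close> has a positive lower bound, and a large
  multiple of it dominates \<open>p\<close>. The lemma is applied with \<open>q = - a\<close>, once
  for the growth rate and once for the linear vanishing of \<open>a\<close>.\<close>

lemma negative_at_zero_imp_coercive:
  fixes p q :: "real \<Rightarrow> real"
  assumes "a < b" and cont: "continuous_on {a..b} p" "continuous_on {a..b} q"
    and q: "\<And>x. x \<in> {a..<b} \<Longrightarrow> 0 < q x" "0 \<le> q b" and neg: "p b < 0"
  obtains d K where "d > 0" "K > 0" "\<And>x. x \<in> {a..b} \<Longrightarrow> p x \<le> - d + K * q x"
proof -
  \<comment> \<open>Half of the gap at \<open>b\<close>: values within \<open>d\<close> of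
    \<open>p b = - 2 * d\<close> stay below \<open>- d\<close>.\<close>
  define d where "d = - p b / 2"
  have d: "d > 0" using neg by (simp add: d_def)
  have "\<exists>e>0. \<forall>x\<in>{a..b}. dist x b < e \<longrightarrow> dist (p x) (p b) < d"
    using cont(1) d \<open>a < b\<close> unfolding continuous_on_iff by auto
  then obtain e where e: "e > 0" "\<And>x. x \<in> {a..b} \<Longrightarrow> dist x b < e \<Longrightarrow> dist (p x) (p b) < d"
    by blast
  \<comment> \<open>Points of \<open>{a..b}\<close> beyond \<open>c\<close> are within
    \<open>e\<close> of \<open>b\<close>, while \<open>c < b\<close> keeps \<open>q\<close> positive
    on the compact interval \<open>{a..c}\<close>.\<close>
  define c where "c = max a (b - e / 2)"
  have c: "a \<le> c" "c < b" using e(1) \<open>a < b\<close> by (auto simp: c_def)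
  obtain k where k: "k > 0" "\<And>x. x \<in> {a..c} \<Longrightarrow> k \<le> q x"
  proof (rule continuous_on_Icc_pos_lower_bound[of a c q])
    show "continuous_on {a..c} q" using cont(2) by (rule continuous_on_subset) (use c in auto)
    show "0 < q x" if "x \<in> {a..c}" for x using q(1)[of x] that c by auto
  qed (use that in auto)
  obtain B where B: "B > 0" "\<And>x. x \<in> {a..b} \<Longrightarrow> \<bar>p x\<bar> \<le> B"
    using continuous_on_Icc_bound[OF cont(1)] by blast
  define K where "K = (B + d) / k"
  have K: "K > 0" using B d k by (simp add: K_def)
  have "p x \<le> - d + K * q x" if x: "x \<in> {a..b}" for x
  proof (cases "x \<le> c")
    case True
    then have "K * k \<le> K * q x" using k(2)[of x] x K by (intro mult_left_mono) auto
    moreover have "K * k = B + d" using k by (simp add: K_def)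
    ultimately show ?thesis using B(2)[OF x] by linarith
  next
    case False
    then have "dist x b < e" using x e(1) by (auto simp: c_def dist_real_def)
    from e(2)[OF x this] have "p x \<le> - d" unfolding dist_real_def d_def by linarith
    moreover have "0 \<le> K * q x" using K q(1)[of x] q(2) x by (cases "x = b") auto
    ultimately show ?thesis by linarith
  qed
  then show thesis using that d K by blast
qed

text \<open>Squaring the positive part removes its corner at 0, where the difference quotient is at
  most \<bar>h\<bar>. This makes the cutoff of the energy argument continuously
  differentiable.\<close>

lemma DERIV_max_zero_square:
  fixes t :: real
  shows "((\<lambda>t. (max 0 t)\<^sup>2) has_real_derivative 2 * max 0 t) (at t)"
proof -
  consider "t > 0" | "t < 0" | "t = 0" by linarith
  then show ?thesis
  proof cases
    case 1
    have "((\<lambda>t. t\<^sup>2) has_real_derivative 2 * max 0 t) (at t)"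
      using 1 by (auto intro!: derivative_eq_intros)
    then show ?thesis
      by (rule has_field_derivative_transform_within_open[of _ _ _ "{0<..}"]) (use 1 in auto)
  next
    case 2
    have "((\<lambda>t. 0) has_real_derivative 2 * max 0 t) (at t)" using 2 by simp
    then show ?thesis
      by (rule has_field_derivative_transform_within_open[of _ _ _ "{..<0}"]) (use 2 in auto)
  next
    case 3
    have "((\<lambda>h. (max 0 h)\<^sup>2 / h) \<longlongrightarrow> 0) (at (0::real))"
    proof (rule Lim_null_comparison)
      show "\<forall>\<^sub>F h in at 0. norm ((max 0 h)\<^sup>2 / h) \<le> \<bar>h\<bar>"
        by (auto simp: max_def power2_eq_square)
      show "((\<lambda>h::real. \<bar>h\<bar>) \<longlongrightarrow> 0) (at 0)" by (intro tendsto_rabs_zero tendsto_ident_at)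
    qed
    then show ?thesis using 3 by (simp add: DERIV_def)
  qed
qed

section \<open>Test functions\<close>

lemma test_function_differentiable:
  assumes "test_function f"
  shows "(f has_real_derivative deriv f x) (at x)"
proof -
  have "(deriv ^^ 0) f differentiable at x" using assms unfolding test_function_def by blast
  then show ?thesis
    by (simp add: DERIV_deriv_iff_real_differentiable)
qed

lemma test_function_vanishes:
  assumes "test_function f"
  obtains R where "\<And>x. \<bar>x\<bar> > R \<Longrightarrow> f x = 0"
proof -
  have "bounded (support_on UNIV f)"
    using assms unfolding test_function_def by (meson bounded_closure_image bounded_subset closure_subset compact_imp_bounded)
  then obtain R where "\<forall>x\<in>support_on UNIV f. norm x \<le> R" unfolding bounded_iff by blast
  then have "f x = 0" if "\<bar>x\<bar> > R" for x
    using that by (force simp: support_on_def)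
  then show thesis using that by blast
qed

text \<open>Off the closed support \<open>f\<close> vanishes in a neighbourhood, so its derivative
  vanishes there too and the support does not grow.\<close>

lemma test_function_deriv:
  assumes "test_function f"
  shows "test_function (deriv f)"
  unfolding test_function_def
proof (intro conjI allI)
  fix n x
  have "(deriv ^^ Suc n) f differentiable at x" using assms unfolding test_function_def by blast
  then show "(deriv ^^ n) (deriv f) differentiable at x" by (simp only: funpow_Suc_right o_apply)
next
  have "support_on UNIV (deriv f) \<subseteq> closure (support_on UNIV f)"
  proof
    fix x assume x: "x \<in> support_on UNIV (deriv f)"
    show "x \<in> closure (support_on UNIV f)"
    proof (rule ccontr)
      assume nx: "x \<notin> closure (support_on UNIV f)"
      have "((\<lambda>_. 0) has_real_derivative 0) (at x)" by simp
      then have "(f has_real_derivative 0) (at x)"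
      proof (rule has_field_derivative_transform_within_open)
        show "open (- closure (support_on UNIV f))" by auto
        show "0 = f y" if "y \<in> - closure (support_on UNIV f)" for y
          using that closure_subset[of "support_on UNIV f"] by (auto simp: support_on_def)
      qed (use nx in auto)
      then show False using x DERIV_imp_deriv by (force simp: support_on_def)
    qed
  qed
  then have "closure (support_on UNIV (deriv f)) \<subseteq> closure (support_on UNIV f)"
    by (simp add: closure_minimal)
  then show "compact (closure (support_on UNIV (deriv f)))"
    using assms unfolding test_function_def by (meson bounded_subset closed_closure compact_eq_bounded_closed)
qed

subsection \<open>Smooth functions on a strip\<close>

lemma Ck_on_strip_continuous:
  "Ck_on_strip k I u \<Longrightarrow> continuous_on (I \<times> UNIV) (\<lambda>(x, \<rho>). u x \<rho>)"
  by (cases k) auto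

lemma smooth_on_strip_continuous:
  "smooth_on_strip I u \<Longrightarrow> continuous_on (I \<times> UNIV) (\<lambda>(x, \<rho>). u x \<rho>)"
  unfolding smooth_on_strip_def using Ck_on_strip_continuous by blast

lemma smooth_on_strip_partial_x: "smooth_on_strip I u \<Longrightarrow> smooth_on_strip I (partial_x I u)"
  unfolding smooth_on_strip_def using Ck_on_strip.simps(2) by blast

lemma smooth_on_strip_partial_rho: "smooth_on_strip I u \<Longrightarrow> smooth_on_strip I (partial_rho u)"
  unfolding smooth_on_strip_def using Ck_on_strip.simps(2) by blast

lemma smooth_on_strip_has_partial_x:
  assumes "smooth_on_strip I u" "x \<in> I"
  shows "((\<lambda>s. u s \<rho>) has_real_derivative partial_x I u x \<rho>) (at x within I)"
proof -
  have "Ck_on_strip (Suc 0) I u" using assms unfolding smooth_on_strip_def by blast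
  then have "(\<lambda>s. u s \<rho>) differentiable (at x within I)" using assms by simp
  then show ?thesis
    unfolding partial_x_def has_real_derivative_iff_has_vector_derivative
    by (simp add: vector_derivative_works)
qed

lemma smooth_on_strip_has_partial_rho:
  assumes "smooth_on_strip I u" "x \<in> I"
  shows "(u x has_real_derivative partial_rho u x \<rho>) (at \<rho>)"
proof -
  have "Ck_on_strip (Suc 0) I u" using assms unfolding smooth_on_strip_def by blast
  then show ?thesis
    using assms unfolding partial_rho_def by (simp add: DERIV_deriv_iff_real_differentiable)
qed

lemma smooth_on_strip_continuous_section:
  assumes "smooth_on_strip I u" "x \<in> I"
  shows "continuous_on S (u x)"
  using smooth_on_strip_has_partial_rho[OF assms]
  by (meson DERIV_isCont continuous_at_imp_continuous_on)

lemma continuous_on_strip_subset: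
  assumes "smooth_on_strip I u" "J \<subseteq> I"
  shows "continuous_on (J \<times> S) (\<lambda>z. u (fst z) (snd z))"
proof -
  have "continuous_on (J \<times> S) (\<lambda>(x, \<rho>). u x \<rho>)"
    by (rule continuous_on_subset[OF smooth_on_strip_continuous[OF assms(1)]]) (use assms(2) in auto)
  then show ?thesis by (simp add: case_prod_unfold)
qed

text \<open>Makes derivatives within the strip unique, including the one-sided derivative at the
  closed end.\<close>

lemma at_within_Ico_neq_bot:
  fixes x :: real
  assumes "x \<in> {a..<b}"
  shows "at x within {a..<b} \<noteq> bot"
proof -
  have "x islimpt {x..(x + b) / 2}" using assms by (auto simp: islimpt_Icc)
  then have "x islimpt {a..<b}" by (rule islimpt_subset) (use assms in auto)
  then show ?thesis by (simp add: trivial_limit_within)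
qed

lemma partial_x_cong:
  assumes "x \<in> I" "\<And>s. s \<in> I \<Longrightarrow> u s \<rho> = v s \<rho>"
  shows "partial_x I u x \<rho> = partial_x I v x \<rho>"
proof -
  have "((\<lambda>s. u s \<rho>) has_vector_derivative d) (at x within I) \<longleftrightarrow>
        ((\<lambda>s. v s \<rho>) has_vector_derivative d) (at x within I)" for d
    by (auto intro: has_vector_derivative_transform_within[OF _ zero_less_one] simp: assms)
  then show ?thesis unfolding partial_x_def vector_derivative_def by simp
qed

text \<open>Differentiating \<open>u x r - u x (\<rho> - 1)\<close>, the integral of \<open>partial_rho u x\<close>, under the integral
  sign gives the equality also at the closed end of the strip, where only one-sided derivatives exist.\<close>

lemma mixed_partials_commute:
  assumes u: "smooth_on_strip {a..<b} u" and x: "x \<in> {a..<b}"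
  shows "partial_rho (partial_x {a..<b} u) x \<rho> = partial_x {a..<b} (partial_rho u) x \<rho>"
proof -
  let ?I = "{a..<b}" and ?Q = "partial_rho u"
  let ?Qx = "partial_x ?I ?Q" and ?P = "partial_x ?I u"
  have Q: "smooth_on_strip ?I ?Q" using smooth_on_strip_partial_rho[OF u] .
  have Qx: "smooth_on_strip ?I ?Qx" using smooth_on_strip_partial_x[OF Q] .
  \<comment> \<open>The base point \<open>\<rho> - 1\<close> lies strictly to the left of
    \<open>\<rho>\<close>, so the identity holds for \<open>r\<close> on both sides of
    \<open>\<rho>\<close> and can be differentiated there.\<close>
  have eq: "?P x r - ?P x (\<rho> - 1) = integral {\<rho> - 1..r} (?Qx x)" if "\<rho> - 1 \<le> r" for r
  proof -
    have ftc: "integral (cbox (\<rho> - 1) r) (?Q s) = u s r - u s (\<rho> - 1)" if "s \<in> ?I" for s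
    proof -
      have "(?Q s has_integral u s r - u s (\<rho> - 1)) {\<rho> - 1..r}"
        using smooth_on_strip_has_partial_rho[OF u that] \<open>\<rho> - 1 \<le> r\<close>
        by (intro fundamental_theorem_of_calculus)
          (auto simp: has_real_derivative_iff_has_vector_derivative[symmetric]
            intro: has_field_derivative_at_within)
      then show ?thesis by (simp add: integral_unique)
    qed
    have "((\<lambda>s. integral (cbox (\<rho> - 1) r) (?Q s)) has_real_derivative
      integral (cbox (\<rho> - 1) r) (?Qx x)) (at x within ?I)"
    proof (rule leibniz_rule_field_derivative)
      show "continuous_on (?I \<times> cbox (\<rho> - 1) r) (\<lambda>(x, t). ?Qx x t)"
        using continuous_on_strip_subset[OF Qx order_refl] by (simp add: case_prod_unfold)
      show "?Q s integrable_on cbox (\<rho> - 1) r" if "s \<in> ?I" for s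
        using integrable_continuous[OF smooth_on_strip_continuous_section[OF Q that]] .
    qed (use smooth_on_strip_has_partial_x[OF Q] x in auto)
    then have "((\<lambda>s. u s r - u s (\<rho> - 1)) has_real_derivative
      integral (cbox (\<rho> - 1) r) (?Qx x)) (at x within ?I)"
      by (rule has_field_derivative_transform_within[OF _ zero_less_one]) (use x ftc in auto)
    moreover have "((\<lambda>s. u s r - u s (\<rho> - 1)) has_real_derivative
      ?P x r - ?P x (\<rho> - 1)) (at x within ?I)"
      using smooth_on_strip_has_partial_x[OF u x] by (intro DERIV_diff)
    ultimately show ?thesis
      using vector_derivative_unique_within[OF at_within_Ico_neq_bot[OF x]]
      by (force simp: has_real_derivative_iff_has_vector_derivative)
  qed
  have "((\<lambda>r. integral {\<rho> - 1..r} (?Qx x)) has_real_derivative ?Qx x \<rho>) (at \<rho> within {\<rho> - 1..\<rho> + 1})"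
    by (rule integral_has_real_derivative)
      (use smooth_on_strip_continuous_section[OF Qx x] in auto)
  then have "((\<lambda>r. ?P x r - ?P x (\<rho> - 1)) has_real_derivative ?Qx x \<rho>) (at \<rho> within {\<rho> - 1..\<rho> + 1})"
    by (rule has_field_derivative_transform_within[OF _ zero_less_one]) (use eq in auto)
  then have "((\<lambda>r. ?P x r - ?P x (\<rho> - 1)) has_real_derivative ?Qx x \<rho>) (at \<rho>)"
    by (simp add: at_within_Icc_at)
  moreover have "((\<lambda>r. ?P x r - ?P x (\<rho> - 1)) has_real_derivative partial_rho ?P x \<rho> - 0) (at \<rho>)"
    by (intro DERIV_diff smooth_on_strip_has_partial_rho[OF smooth_on_strip_partial_x[OF u] x] DERIV_const)
  ultimately show ?thesis using DERIV_unique by fastforce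
qed

subsection \<open>Wave equations degenerating at one end\<close>

text \<open>The coefficients are controlled on the closed interval while solutions live on the
  half-open one, so bounds on coefficients are uniform up to \<open>xc\<close>. The assumption
  \<open>a'_end\<close> makes \<open>a\<close> vanish to first order at \<open>xc\<close>;
  \<open>dissipative\<close> is the sign at \<open>xc\<close> of the coefficient
  \<open>2 * p - a'\<close> of \<open>u\<^sub>x\<^sup>2\<close>.\<close>

locale degenerate_wave =
  fixes xi xc :: real and a a' b c c' h h' p q :: "real \<Rightarrow> real"
  assumes xi_less_xc: "xi < xc"
    and a_deriv: "\<And>x. x \<in> {xi..xc} \<Longrightarrow> (a has_real_derivative a' x) (at x within {xi..xc})"
    and c_deriv: "\<And>x. x \<in> {xi..xc} \<Longrightarrow> (c has_real_derivative c' x) (at x within {xi..xc})"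
    and h_deriv: "\<And>x. x \<in> {xi..xc} \<Longrightarrow> (h has_real_derivative h' x) (at x within {xi..xc})"
    and coeffs_continuous: "continuous_on {xi..xc} a'" "continuous_on {xi..xc} b"
      "continuous_on {xi..xc} c'" "continuous_on {xi..xc} h'"
      "continuous_on {xi..xc} p" "continuous_on {xi..xc} q"
    and a_neg: "\<And>x. x \<in> {xi..<xc} \<Longrightarrow> a x < 0" and a_end: "a xc = 0" and a'_end: "a' xc > 0"
    and c_pos: "\<And>x. x \<in> {xi..xc} \<Longrightarrow> c x > 0"
    and h_nonneg: "\<And>x. x \<in> {xi..xc} \<Longrightarrow> h x \<ge> 0"
    and dissipative: "2 * p xc < a' xc"
begin

abbreviation "I \<equiv> {xi..<xc}"

definition solves :: "(real \<Rightarrow> real \<Rightarrow> real) \<Rightarrow> bool" where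
  "solves u \<longleftrightarrow> smooth_on_strip I u \<and>
    (\<forall>x\<in>I. \<forall>\<rho>. a x * partial_x I (partial_x I u) x \<rho> + 2 * b x * partial_rho (partial_x I u) x \<rho>
      + c x * partial_rho (partial_rho u) x \<rho> + p x * partial_x I u x \<rho>
      + q x * partial_rho u x \<rho> - h x * u x \<rho> = 0)"

text \<open>A positive \<open>lam\<close> adds control of \<open>u\<close> itself, because
  \<open>h\<close> may vanish; \<open>lam = 0\<close> is the energy density of the theorem.\<close>

definition dens :: "real \<Rightarrow> (real \<Rightarrow> real \<Rightarrow> real) \<Rightarrow> real \<Rightarrow> real \<Rightarrow> real" where
  "dens lam u x \<rho> = - a x * (partial_x I u x \<rho>)\<^sup>2 + c x * (partial_rho u x \<rho>)\<^sup>2 + (h x + lam) * (u x \<rho>)\<^sup>2"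

lemma solves_smooth: "solves u \<Longrightarrow> smooth_on_strip I u"
  unfolding solves_def by blast

text \<open>The coefficients depend on \<open>x\<close> alone, so differentiating the equation in
  \<open>\<rho>\<close> reproduces it once mixed partials are exchanged. For the second
  \<open>x\<close>-derivative the exchange is made twice: for \<open>partial_x I u\<close>, then
  under the outer derivative.\<close>

lemma solves_partial_rho:
  assumes "solves u"
  shows "solves (partial_rho u)"
proof -
  have u: "smooth_on_strip I u" using assms by (rule solves_smooth)
  note P = smooth_on_strip_partial_x[OF u] and Q = smooth_on_strip_partial_rho[OF u]
  have Px: "partial_rho (partial_x I u) x \<rho> = partial_x I (partial_rho u) x \<rho>" if "x \<in> I" for x \<rho>
    by (rule mixed_partials_commute[OF u that])
  have Pxx: "partial_rho (partial_x I (partial_x I u)) x \<rho> = partial_x I (partial_x I (partial_rho u)) x \<rho>"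
    if x: "x \<in> I" for x \<rho>
  proof -
    have "partial_rho (partial_x I (partial_x I u)) x \<rho> = partial_x I (partial_rho (partial_x I u)) x \<rho>"
      by (rule mixed_partials_commute[OF P x])
    also have "\<dots> = partial_x I (partial_x I (partial_rho u)) x \<rho>"
      by (rule partial_x_cong[OF x]) (rule Px)
    finally show ?thesis .
  qed
  have "a x * partial_x I (partial_x I (partial_rho u)) x \<rho>
      + 2 * b x * partial_rho (partial_x I (partial_rho u)) x \<rho>
      + c x * partial_rho (partial_rho (partial_rho u)) x \<rho> + p x * partial_x I (partial_rho u) x \<rho>
      + q x * partial_rho (partial_rho u) x \<rho> - h x * partial_rho u x \<rho> = 0" if x: "x \<in> I" for x \<rho>
  proof -
    let ?w = "\<lambda>\<rho>. a x * partial_x I (partial_x I u) x \<rho> + 2 * b x * partial_rho (partial_x I u) x \<rho>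
      + c x * partial_rho (partial_rho u) x \<rho> + p x * partial_x I u x \<rho>
      + q x * partial_rho u x \<rho> - h x * u x \<rho>"
    \<comment> \<open>\<open>partial_rho\<close> at \<open>x\<close> sees only the section at
      \<open>x\<close>, so equality of these two sections allows the exchange under a further
      \<open>\<rho>\<close>-derivative.\<close>
    have "partial_rho (partial_x I u) x = partial_x I (partial_rho u) x"
      using Px[OF x] by blast
    then have Pr: "partial_rho (partial_rho (partial_x I u)) x \<rho> = partial_rho (partial_x I (partial_rho u)) x \<rho>"
      unfolding partial_rho_def[of "partial_rho (partial_x I u)"]
        partial_rho_def[of "partial_x I (partial_rho u)"] by simp
    note d = smooth_on_strip_has_partial_rho[OF _ x]
    have "(?w has_real_derivative
       a x * partial_rho (partial_x I (partial_x I u)) x \<rho>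
      + 2 * b x * partial_rho (partial_rho (partial_x I u)) x \<rho>
      + c x * partial_rho (partial_rho (partial_rho u)) x \<rho> + p x * partial_rho (partial_x I u) x \<rho>
      + q x * partial_rho (partial_rho u) x \<rho> - h x * partial_rho u x \<rho>) (at \<rho>)"
      by (intro DERIV_diff DERIV_add DERIV_cmult d smooth_on_strip_partial_x smooth_on_strip_partial_rho u)
    moreover have "?w = (\<lambda>_. 0)" using assms x unfolding solves_def by auto
    ultimately have "a x * partial_rho (partial_x I (partial_x I u)) x \<rho>
      + 2 * b x * partial_rho (partial_rho (partial_x I u)) x \<rho>
      + c x * partial_rho (partial_rho (partial_rho u)) x \<rho> + p x * partial_rho (partial_x I u) x \<rho>
      + q x * partial_rho (partial_rho u) x \<rho> - h x * partial_rho u x \<rho> = 0"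
      using DERIV_unique[OF _ DERIV_const] by force
    then show ?thesis using Px[OF x] Pxx[OF x] Pr by simp
  qed
  with Q show ?thesis unfolding solves_def by blast
qed

section \<open>The modified energy density and its growth rate\<close>

lemma a_cont: "continuous_on {xi..xc} a" and c_cont: "continuous_on {xi..xc} c"
  and h_cont: "continuous_on {xi..xc} h"
  using a_deriv c_deriv h_deriv by (meson DERIV_continuous_on)+

lemma dens_eq: "dens lam u x \<rho> = dens 0 u x \<rho> + lam * (u x \<rho>)\<^sup>2"
  by (simp add: dens_def algebra_simps)

lemma dens_lower_bounds:
  assumes "x \<in> I" "0 \<le> lam"
  shows "- a x * (partial_x I u x \<rho>)\<^sup>2 \<le> dens lam u x \<rho>"
    "c x * (partial_rho u x \<rho>)\<^sup>2 \<le> dens lam u x \<rho>"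
    "lam * (u x \<rho>)\<^sup>2 \<le> dens lam u x \<rho>"
    "- a x * (partial_x I u x \<rho>)\<^sup>2 + c x * (partial_rho u x \<rho>)\<^sup>2 \<le> dens lam u x \<rho>"
    "0 \<le> dens lam u x \<rho>"
proof -
  have "0 \<le> - a x * (partial_x I u x \<rho>)\<^sup>2" "0 \<le> c x * (partial_rho u x \<rho>)\<^sup>2"
    "0 \<le> h x * (u x \<rho>)\<^sup>2" "0 \<le> lam * (u x \<rho>)\<^sup>2"
    using assms a_neg[of x] c_pos[of x] h_nonneg[of x] by (auto simp: mult_nonpos_nonneg)
  then show "- a x * (partial_x I u x \<rho>)\<^sup>2 \<le> dens lam u x \<rho>"
    "c x * (partial_rho u x \<rho>)\<^sup>2 \<le> dens lam u x \<rho>"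
    "lam * (u x \<rho>)\<^sup>2 \<le> dens lam u x \<rho>"
    "- a x * (partial_x I u x \<rho>)\<^sup>2 + c x * (partial_rho u x \<rho>)\<^sup>2 \<le> dens lam u x \<rho>"
    "0 \<le> dens lam u x \<rho>"
    unfolding dens_def distrib_right by linarith+
qed

lemma dens_continuous:
  assumes "smooth_on_strip I u" "x \<in> I"
  shows "continuous_on S (dens lam u x)"
  unfolding dens_def
  by (intro continuous_intros smooth_on_strip_continuous_section[OF _ assms(2)]
      smooth_on_strip_partial_x smooth_on_strip_partial_rho assms(1))

text \<open>With \<open>P\<close>, \<open>Q\<close>, \<open>v\<close> standing for
  \<open>u\<^sub>x\<close>, \<open>u\<^sub>\<rho>\<close>, \<open>u\<close>, the left side is what
  remains of the \<open>x\<close>-derivative of the density after the equation is used and a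
  \<open>\<rho>\<close>-derivative is split off. A single \<open>M\<close> has to serve every
  \<open>x\<close> up to \<open>xc\<close>.\<close>

definition growth_rate :: "real \<Rightarrow> real \<Rightarrow> bool" where
  "growth_rate lam M \<longleftrightarrow> 0 \<le> M \<and> (\<forall>x\<in>I. \<forall>P Q v.
    (2 * p x - a' x) * P\<^sup>2 + 2 * q x * P * Q + c' x * Q\<^sup>2 + h' x * v\<^sup>2 + 2 * lam * v * P
      \<le> M * (- a x * P\<^sup>2 + c x * Q\<^sup>2 + (h x + lam) * v\<^sup>2))"

text \<open>The coefficient of \<open>P\<^sup>2\<close> is at most \<open>- d + K * - a x\<close>,
  so a strictly negative part survives where \<open>- a\<close> degenerates. It absorbs the terms
  that mix \<open>P\<close> with \<open>Q\<close> and \<open>v\<close>; what these leave behind is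
  controlled by the lower bound of \<open>c\<close> and by \<open>lam > 0\<close>.\<close>

lemma growth_rate_exists:
  assumes lam: "lam > 0"
  obtains M where "growth_rate lam M"
proof -
  obtain d K where d: "d > 0" and K: "K > 0"
    and co: "\<And>x. x \<in> {xi..xc} \<Longrightarrow> 2 * p x - a' x \<le> - d + K * - a x"
  proof (rule negative_at_zero_imp_coercive[OF xi_less_xc, of "\<lambda>x. 2 * p x - a' x" "\<lambda>x. - a x"])
    show "continuous_on {xi..xc} (\<lambda>x. 2 * p x - a' x)" "continuous_on {xi..xc} (\<lambda>x. - a x)"
      by (intro continuous_intros coeffs_continuous a_cont)+
  qed (use a_neg a_end dissipative in auto)
  obtain k where k: "k > 0" "\<And>x. x \<in> {xi..xc} \<Longrightarrow> k \<le> c x"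
    using continuous_on_Icc_pos_lower_bound[OF c_cont c_pos] by blast
  obtain B where B: "B > 0" "\<And>x. x \<in> {xi..xc} \<Longrightarrow> \<bar>2 * (q x)\<^sup>2 / d + c' x\<bar> \<le> B"
    by (rule continuous_on_Icc_bound[of xi xc "\<lambda>x. 2 * (q x)\<^sup>2 / d + c' x"])
      (use d in \<open>auto intro!: continuous_intros coeffs_continuous\<close>)
  obtain H where H: "H > 0" "\<And>x. x \<in> {xi..xc} \<Longrightarrow> \<bar>h' x + 2 * lam\<^sup>2 / d\<bar> \<le> H"
    by (rule continuous_on_Icc_bound[of xi xc "\<lambda>x. h' x + 2 * lam\<^sup>2 / d"])
      (use d in \<open>auto intro!: continuous_intros coeffs_continuous\<close>)
  \<comment> \<open>The summands pay for the terms in \<open>P\<^sup>2\<close>,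
    \<open>Q\<^sup>2\<close> and \<open>v\<^sup>2\<close>, in this order; \<open>B\<close> and
    \<open>H\<close> include the remainders of the mixed terms.\<close>
  define M where "M = K + B / k + H / lam"
  have M: "M \<ge> K" "M \<ge> 0" "B / k \<le> M" "H / lam \<le> M"
    using K B k H lam by (auto simp: M_def)
  have "(2 * p x - a' x) * P\<^sup>2 + 2 * q x * P * Q + c' x * Q\<^sup>2 + h' x * v\<^sup>2 + 2 * lam * v * P
      \<le> M * (- a x * P\<^sup>2 + c x * Q\<^sup>2 + (h x + lam) * v\<^sup>2)" if x: "x \<in> I" for x P Q v
  proof -
    have x': "x \<in> {xi..xc}" using x by auto
    \<comment> \<open>Young's inequality, used once for \<open>q x * Q\<close> and once for
      \<open>lam * v\<close>: together they consume exactly the available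
      \<open>- d * P\<^sup>2\<close>.\<close>
    have AM: "2 * y * P \<le> d / 2 * P\<^sup>2 + 2 * y\<^sup>2 / d" for y
    proof -
      have "0 \<le> (d * P - 2 * y)\<^sup>2 / (2 * d)" using d by simp
      also have "\<dots> = d / 2 * P\<^sup>2 + 2 * y\<^sup>2 / d - 2 * y * P"
        using d by (simp add: power2_eq_square field_simps)
      finally show ?thesis by simp
    qed
    have 1: "(2 * p x - a' x) * P\<^sup>2 \<le> - d * P\<^sup>2 + K * (- a x * P\<^sup>2)"
      using mult_right_mono[OF co[OF x'], of "P\<^sup>2"] by (simp add: algebra_simps)
    have 2: "K * (- a x * P\<^sup>2) \<le> M * (- a x * P\<^sup>2)"
      using M a_neg[OF x] by (intro mult_right_mono) (auto simp: mult_nonpos_nonneg)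
    have 3: "(2 * (q x)\<^sup>2 / d + c' x) * Q\<^sup>2 \<le> M * (c x * Q\<^sup>2)"
    proof -
      have "2 * (q x)\<^sup>2 / d + c' x \<le> B" using B(2)[OF x'] by linarith
      also have "B = B / k * k" using k by simp
      also have "\<dots> \<le> M * c x" using M B k(1) k(2)[OF x'] by (intro mult_mono) auto
      finally have le: "2 * (q x)\<^sup>2 / d + c' x \<le> M * c x" .
      show ?thesis using mult_right_mono[OF le, of "Q\<^sup>2", OF zero_le_power2] by (simp add: mult.assoc del: mult_le_cancel_right)
    qed
    have 4: "(h' x + 2 * lam\<^sup>2 / d) * v\<^sup>2 \<le> M * ((h x + lam) * v\<^sup>2)"
    proof -
      have "h' x + 2 * lam\<^sup>2 / d \<le> H" using H(2)[OF x'] by linarith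
      also have "H = H / lam * lam" using lam by simp
      also have "\<dots> \<le> M * (h x + lam)" using M H lam h_nonneg[OF x'] by (intro mult_mono) auto
      finally have le: "h' x + 2 * lam\<^sup>2 / d \<le> M * (h x + lam)" .
      show ?thesis using mult_right_mono[OF le, of "v\<^sup>2", OF zero_le_power2] by (simp add: mult.assoc del: mult_le_cancel_right)
    qed
    have 5: "2 * (q x * Q) * P \<le> d / 2 * P\<^sup>2 + 2 * (q x * Q)\<^sup>2 / d" by (rule AM)
    have 6: "2 * (lam * v) * P \<le> d / 2 * P\<^sup>2 + 2 * (lam * v)\<^sup>2 / d" by (rule AM)
    show ?thesis
      using 1 2 3 4 5 6 by (simp add: algebra_simps power_mult_distrib)
  qed
  with M that show thesis unfolding growth_rate_def by blast
qed

section \<open>The energy identity\<close>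

definition dens_x :: "real \<Rightarrow> (real \<Rightarrow> real \<Rightarrow> real) \<Rightarrow> real \<Rightarrow> real \<Rightarrow> real" where
  "dens_x lam u x \<rho> =
     - a' x * (partial_x I u x \<rho>)\<^sup>2 - 2 * a x * partial_x I u x \<rho> * partial_x I (partial_x I u) x \<rho>
     + c' x * (partial_rho u x \<rho>)\<^sup>2 + 2 * c x * partial_rho u x \<rho> * partial_x I (partial_rho u) x \<rho>
     + h' x * (u x \<rho>)\<^sup>2 + 2 * (h x + lam) * u x \<rho> * partial_x I u x \<rho>"

text \<open>Found by collecting the second-order terms of the energy identity:
  \<open>4 * b * u\<^sub>x * u\<^sub>x\<^sub>\<rho>\<close> and \<open>2 * c * (u\<^sub>x *
  u\<^sub>\<rho>\<^sub>\<rho> + u\<^sub>\<rho> * u\<^sub>x\<^sub>\<rho>)\<close> form an exact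
  \<open>\<rho>\<close>-derivative.\<close>

definition flux :: "(real \<Rightarrow> real \<Rightarrow> real) \<Rightarrow> real \<Rightarrow> real \<Rightarrow> real" where
  "flux u x \<rho> = 2 * b x * (partial_x I u x \<rho>)\<^sup>2 + 2 * c x * partial_x I u x \<rho> * partial_rho u x \<rho>"

definition flux_rho :: "(real \<Rightarrow> real \<Rightarrow> real) \<Rightarrow> real \<Rightarrow> real \<Rightarrow> real" where
  "flux_rho u x \<rho> = 4 * b x * partial_x I u x \<rho> * partial_rho (partial_x I u) x \<rho>
     + 2 * c x * (partial_rho (partial_x I u) x \<rho> * partial_rho u x \<rho>
                + partial_x I u x \<rho> * partial_rho (partial_rho u) x \<rho>)"

lemma dens_has_dens_x:
  assumes u: "smooth_on_strip I u" and x: "x \<in> I"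
  shows "((\<lambda>s. dens lam u s \<rho>) has_real_derivative dens_x lam u x \<rho>) (at x within I)"
proof -
  note d = smooth_on_strip_has_partial_x[OF u x] smooth_on_strip_has_partial_x[OF smooth_on_strip_partial_x[OF u] x]
    smooth_on_strip_has_partial_x[OF smooth_on_strip_partial_rho[OF u] x]
  have coeff: "(a has_real_derivative a' x) (at x within I)" "(c has_real_derivative c' x) (at x within I)"
    "(h has_real_derivative h' x) (at x within I)"
    using a_deriv[of x] c_deriv[of x] h_deriv[of x] x
    by (auto intro: has_field_derivative_subset)
  show ?thesis
    unfolding dens_def dens_x_def
    by (rule derivative_eq_intros d coeff refl)+ (simp add: algebra_simps power2_eq_square)
qed

lemma flux_has_flux_rho:
  assumes u: "smooth_on_strip I u" and x: "x \<in> I"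
  shows "(flux u x has_real_derivative flux_rho u x \<rho>) (at \<rho>)"
proof -
  note d = smooth_on_strip_has_partial_rho[OF u x] smooth_on_strip_has_partial_rho[OF smooth_on_strip_partial_x[OF u] x]
    smooth_on_strip_has_partial_rho[OF smooth_on_strip_partial_rho[OF u] x]
  have "((\<lambda>\<rho>. 2 * b x * (partial_x I u x \<rho>)\<^sup>2 + 2 * c x * partial_x I u x \<rho> * partial_rho u x \<rho>)
    has_real_derivative flux_rho u x \<rho>) (at \<rho>)"
    unfolding flux_rho_def
    by (rule derivative_eq_intros d refl)+ (simp add: algebra_simps power2_eq_square)
  then show ?thesis unfolding flux_def[abs_def] .
qed

text \<open>\<open>u\<^sub>x\<^sub>x\<close> occurs only multiplied by \<open>a\<close>, so the
  equation eliminates it without division by the degenerate coefficient. The terms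
  \<open>2 * h * u * u\<^sub>x\<close> cancel, and the rest beyond \<open>flux_rho\<close> is the
  quadratic form of \<open>growth_rate\<close>.\<close>

lemma dens_x_le:
  assumes u: "solves u" and x: "x \<in> I" and M: "growth_rate lam M"
  shows "dens_x lam u x \<rho> \<le> M * dens lam u x \<rho> + flux_rho u x \<rho>"
proof -
  let ?P = "partial_x I u x \<rho>" and ?Q = "partial_rho u x \<rho>" and ?v = "u x \<rho>"
  have pde: "a x * partial_x I (partial_x I u) x \<rho> = - (2 * b x * partial_rho (partial_x I u) x \<rho>
      + c x * partial_rho (partial_rho u) x \<rho> + p x * ?P + q x * ?Q - h x * ?v)"
    using u x unfolding solves_def by (simp add: algebra_simps eq_neg_iff_add_eq_0)
  have mixed: "partial_x I (partial_rho u) x \<rho> = partial_rho (partial_x I u) x \<rho>"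
    using mixed_partials_commute[OF solves_smooth[OF u] x] by simp
  have "2 * a x * ?P * partial_x I (partial_x I u) x \<rho>
      = 2 * ?P * (a x * partial_x I (partial_x I u) x \<rho>)" by simp
  then have "dens_x lam u x \<rho> - flux_rho u x \<rho> = (2 * p x - a' x) * ?P\<^sup>2 + 2 * q x * ?P * ?Q
      + c' x * ?Q\<^sup>2 + h' x * ?v\<^sup>2 + 2 * lam * ?v * ?P"
    unfolding dens_x_def flux_rho_def pde mixed by (simp add: algebra_simps power2_eq_square)
  also have "\<dots> \<le> M * dens lam u x \<rho>"
    using M x unfolding growth_rate_def dens_def by blast
  finally show ?thesis by simp
qed

section \<open>Energy growth by localisation with a shrinking cutoff\<close>

text \<open>For positive \<open>v\<close> and \<open>e\<close> this truncation is supported in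
  \<bar>\<rho>\<bar> \<le> 1/e when \<open>x \<ge> x1\<close>, and it tends to 1 as \<open>e\<close>
  tends to 0. The parameter \<open>v\<close> acts as a propagation speed and \<open>e\<close> as an
  inverse length.\<close>

definition cutoff :: "real \<Rightarrow> real \<Rightarrow> real \<Rightarrow> real \<Rightarrow> real \<Rightarrow> real" where
  "cutoff x1 v e x \<rho> = (max 0 (1 - 2 * v * e * (x - x1) - e\<^sup>2 * \<rho>\<^sup>2))\<^sup>2"

text \<open>Since \<open>x2 < xc\<close>, the coefficient \<open>- a\<close> has a positive lower
  bound on \<open>{x1..x2}\<close>, and the density dominates \<open>u\<^sub>x\<^sup>2\<close>. The
  bound \<open>v\<close> may blow up as \<open>x2\<close> approaches \<open>xc\<close>; it enters
  only the cutoff and disappears when the cutoff is removed.\<close>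

lemma flux_le_dens:
  assumes "x1 \<in> I" "x2 \<in> I" "x1 \<le> x2" "0 \<le> lam"
  obtains v where "v > 0" "\<And>u x \<rho>. x \<in> {x1..x2} \<Longrightarrow> \<bar>flux u x \<rho>\<bar> \<le> v * dens lam u x \<rho>"
proof -
  have sub: "{x1..x2} \<subseteq> {xi..xc}" using assms by auto
  obtain k where k: "k > 0" "\<And>x. x \<in> {x1..x2} \<Longrightarrow> k \<le> - a x"
  proof (rule continuous_on_Icc_pos_lower_bound[of x1 x2 "\<lambda>x. - a x"])
    show "continuous_on {x1..x2} (\<lambda>x. - a x)"
      by (intro continuous_intros continuous_on_subset[OF a_cont sub])
    show "0 < - a x" if "x \<in> {x1..x2}" for x using a_neg[of x] that assms by auto
  qed blast
  have cont: "continuous_on {x1..x2} (\<lambda>x. 2 * \<bar>b x\<bar> + c x)"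
    by (intro continuous_intros continuous_on_subset[OF coeffs_continuous(2) sub]
        continuous_on_subset[OF c_cont sub])
  obtain B where B: "B > 0" "\<And>x. x \<in> {x1..x2} \<Longrightarrow> \<bar>2 * \<bar>b x\<bar> + c x\<bar> \<le> B"
    using continuous_on_Icc_bound[OF cont] by blast
  \<comment> \<open>\<open>B / k\<close> pays for the term in \<open>u\<^sub>x\<^sup>2\<close>, the
    summand 1 for the term in \<open>u\<^sub>\<rho>\<^sup>2\<close>.\<close>
  define v where "v = 1 + B / k"
  have v: "v \<ge> 1" "B / k \<le> v" "v * k \<ge> B" using k B by (auto simp: v_def field_simps)
  have "\<bar>flux u x \<rho>\<bar> \<le> v * dens lam u x \<rho>" if x: "x \<in> {x1..x2}" for u x \<rho>
  proof -
    let ?P = "partial_x I u x \<rho>" and ?Q = "partial_rho u x \<rho>"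
    have xI: "x \<in> I" and c0: "c x > 0" using x assms c_pos[of x] by auto
    have "\<bar>flux u x \<rho>\<bar> \<le> \<bar>2 * b x * ?P\<^sup>2\<bar> + \<bar>2 * c x * ?P * ?Q\<bar>"
      unfolding flux_def by (rule abs_triangle_ineq)
    also have "\<bar>2 * b x * ?P\<^sup>2\<bar> = 2 * \<bar>b x\<bar> * ?P\<^sup>2" by (simp add: abs_mult)
    also have "\<bar>2 * c x * ?P * ?Q\<bar> = c x * (2 * \<bar>?P\<bar> * \<bar>?Q\<bar>)"
      using c0 by (simp add: abs_mult)
    also have "\<dots> \<le> c x * (?P\<^sup>2 + ?Q\<^sup>2)"
      using sum_squares_bound[of "\<bar>?P\<bar>" "\<bar>?Q\<bar>"] c0 by (intro mult_left_mono) auto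
    finally have "\<bar>flux u x \<rho>\<bar> \<le> (2 * \<bar>b x\<bar> + c x) * ?P\<^sup>2 + c x * ?Q\<^sup>2"
      by (simp add: algebra_simps)
    also have "\<dots> \<le> v * (- a x * ?P\<^sup>2) + v * (c x * ?Q\<^sup>2)"
    proof (rule add_mono)
      have "2 * \<bar>b x\<bar> + c x \<le> v * k" using B(2)[OF x] v by linarith
      also have "\<dots> \<le> v * - a x" using k(2)[OF x] v by (intro mult_left_mono) auto
      finally have le: "2 * \<bar>b x\<bar> + c x \<le> v * - a x" .
      show "(2 * \<bar>b x\<bar> + c x) * ?P\<^sup>2 \<le> v * (- a x * ?P\<^sup>2)" using mult_right_mono[OF le, of "?P\<^sup>2", OF zero_le_power2] by (simp add: mult.assoc del: mult_le_cancel_right)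
      show "c x * ?Q\<^sup>2 \<le> v * (c x * ?Q\<^sup>2)" using mult_right_mono[OF v(1), of "c x * ?Q\<^sup>2"] c0 by simp
    qed
    also have "\<dots> \<le> v * dens lam u x \<rho>"
      using mult_left_mono[OF dens_lower_bounds(4)[OF xI \<open>0 \<le> lam\<close>, of u \<rho>], of v] v
      by (simp add: algebra_simps)
    finally show ?thesis .
  qed
  with v(1) show thesis by (intro that[of v]) auto
qed

text \<open>The cutoff shrinks in \<open>x\<close> fast enough to absorb the flux through its boundary, which
  replaces an argument by finite speed of propagation.\<close>

lemma cutoff_energy_decreasing:
  assumes u: "solves u" and M: "growth_rate lam M" and lam: "0 \<le> lam"
    and x12: "x1 \<in> I" "x2 \<in> I" "x1 \<le> x2"
    and v: "v > 0" "\<And>x \<rho>. x \<in> {x1..x2} \<Longrightarrow> \<bar>flux u x \<rho>\<bar> \<le> v * dens lam u x \<rho>" and e: "e > 0"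
  defines "W \<equiv> \<lambda>x. integral {- (1 / e)..1 / e} (\<lambda>\<rho>. cutoff x1 v e x \<rho> * dens lam u x \<rho>)"
  shows "exp (- M * x2) * W x2 \<le> exp (- M * x1) * W x1"
proof -
  note uS = solves_smooth[OF u]
  note P = smooth_on_strip_partial_x[OF uS] and Q = smooth_on_strip_partial_rho[OF uS]
  have sub: "{x1..x2} \<subseteq> I" using x12 by auto
  have sub': "{x1..x2} \<subseteq> {xi..xc}" using x12 by auto
  define m where "m x \<rho> = max 0 (1 - 2 * v * e * (x - x1) - e\<^sup>2 * \<rho>\<^sup>2)" for x \<rho>
  have m0: "m x \<rho> \<ge> 0" for x \<rho> by (simp add: m_def)
  have cut: "cutoff x1 v e x \<rho> = (m x \<rho>)\<^sup>2" for x \<rho> by (simp add: cutoff_def m_def)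
  have cut_x: "((\<lambda>s. cutoff x1 v e s \<rho>) has_real_derivative - 4 * v * e * m x \<rho>) (at x within S)" for x \<rho> S
  proof -
    have "((\<lambda>s. 1 - 2 * v * e * (s - x1) - e\<^sup>2 * \<rho>\<^sup>2) has_real_derivative - (2 * v * e)) (at x within S)"
      by (auto intro!: derivative_eq_intros)
    from DERIV_chain2[OF DERIV_max_zero_square this] show ?thesis
      unfolding cutoff_def m_def by (simp add: mult_ac)
  qed
  have cut_rho: "(cutoff x1 v e x has_real_derivative - 4 * e\<^sup>2 * \<rho> * m x \<rho>) (at \<rho>)" for x \<rho>
  proof -
    have "((\<lambda>\<rho>. 1 - 2 * v * e * (x - x1) - e\<^sup>2 * \<rho>\<^sup>2) has_real_derivative - (e\<^sup>2 * (2 * \<rho>))) (at \<rho>)"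
      by (auto intro!: derivative_eq_intros)
    from DERIV_chain2[OF DERIV_max_zero_square this] show ?thesis
      unfolding cutoff_def[abs_def] m_def by (simp add: mult_ac)
  qed
  \<comment> \<open>The \<open>x\<close>-derivative of the truncated density; its first term, which
    is nonpositive, is the gain from the shrinking cutoff.\<close>
  define w' where "w' x \<rho> = - 4 * v * e * m x \<rho> * dens lam u x \<rho> + dens_x lam u x \<rho> * cutoff x1 v e x \<rho>" for x \<rho>
  have cutcont: "continuous_on S (\<lambda>\<rho>. cutoff x1 v e x \<rho>)" for x S
    unfolding cutoff_def by (intro continuous_intros)
  \<comment> \<open>The interval of integration does not move with \<open>x\<close>, so
    differentiation under the integral produces no boundary terms.\<close>
  have Wder: "(W has_real_derivative integral {- (1 / e)..1 / e} (w' x)) (at x within {x1..x2})"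
    if x: "x \<in> {x1..x2}" for x
  proof -
    let ?R = "cbox (- (1 / e)) (1 / e)"
    have "((\<lambda>x. integral ?R (\<lambda>\<rho>. cutoff x1 v e x \<rho> * dens lam u x \<rho>)) has_real_derivative
      integral ?R (w' x)) (at x within {x1..x2})"
    proof (rule leibniz_rule_field_derivative)
      fix s t assume s: "s \<in> {x1..x2}"
      show "((\<lambda>s. cutoff x1 v e s t * dens lam u s t) has_real_derivative w' s t) (at s within {x1..x2})"
        unfolding w'_def
        by (rule DERIV_mult[OF cut_x has_field_derivative_subset[OF dens_has_dens_x[OF uS] sub]])
          (use s sub in auto)
    next
      fix s assume s: "s \<in> {x1..x2}"
      show "(\<lambda>\<rho>. cutoff x1 v e s \<rho> * dens lam u s \<rho>) integrable_on cbox (- (1 / e)) (1 / e)"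
        by (intro integrable_continuous continuous_on_mult cutcont dens_continuous[OF uS]) (use s sub in auto)
    next
      let ?S = "{x1..x2} \<times> cbox (- (1 / e)) (1 / e)"
      have C: "continuous_on ?S (\<lambda>z. k (fst z))" if "continuous_on {xi..xc} k" for k :: "real \<Rightarrow> real"
        by (rule continuous_on_compose2[OF that]) (use sub' in \<open>auto intro!: continuous_intros\<close>)
      have U: "continuous_on ?S (\<lambda>z. k (fst z) (snd z))" if "smooth_on_strip I k" for k
        by (rule continuous_on_strip_subset[OF that sub])
      show "continuous_on ?S (\<lambda>(x, t). w' x t)"
        unfolding w'_def dens_def dens_x_def cutoff_def m_def case_prod_unfold
        by (intro continuous_intros coeffs_continuous[THEN C] a_cont[THEN C] c_cont[THEN C] h_cont[THEN C]
            uS[THEN U] P[THEN U] Q[THEN U] smooth_on_strip_partial_x[OF P, THEN U]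
            smooth_on_strip_partial_x[OF Q, THEN U])
    qed (use x in auto)
    then show ?thesis by (simp add: W_def)
  qed
  have le: "integral {- (1 / e)..1 / e} (w' x) \<le> M * W x" if x: "x \<in> {x1..x2}" for x
  proof -
    have xI: "x \<in> I" using x sub by auto
    \<comment> \<open>The \<open>\<rho>\<close>-derivative of cutoff times flux; it integrates to 0
      because the cutoff vanishes at both end points.\<close>
    let ?g = "\<lambda>\<rho>. - 4 * e\<^sup>2 * \<rho> * m x \<rho> * flux u x \<rho> + flux_rho u x \<rho> * cutoff x1 v e x \<rho>"
    have "((\<lambda>\<rho>. cutoff x1 v e x \<rho> * flux u x \<rho>) has_real_derivative ?g \<rho>) (at \<rho>)" for \<rho>
      by (rule DERIV_mult[OF cut_rho flux_has_flux_rho[OF uS xI]])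
    then have "(?g has_integral (cutoff x1 v e x (1 / e) * flux u x (1 / e)
        - cutoff x1 v e x (- (1 / e)) * flux u x (- (1 / e)))) {- (1 / e)..1 / e}"
      using e by (intro fundamental_theorem_of_calculus)
        (auto simp: has_real_derivative_iff_has_vector_derivative[symmetric]
          intro: has_field_derivative_at_within)
    moreover have "cutoff x1 v e x (1 / e) = 0" "cutoff x1 v e x (- (1 / e)) = 0"
      using e v(1) x mult_pos_pos[OF e mult_pos_pos[OF v(1), of "x - x1"]]
      by (fastforce simp: cutoff_def power_divide max_def)+
    ultimately have g: "(?g has_integral 0) {- (1 / e)..1 / e}" by simp
    have ww: "((\<lambda>\<rho>. cutoff x1 v e x \<rho> * dens lam u x \<rho>) has_integral W x) {- (1 / e)..1 / e}"
      unfolding W_def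
      by (intro integrable_integral integrable_continuous_real continuous_on_mult cutcont dens_continuous[OF uS xI])
    note sec = smooth_on_strip_continuous_section[OF _ xI]
    \<comment> \<open>Since \<bar>e * \<rho>\<bar> \<le> 1 and the flux is at most \<open>v\<close>
      times the density, the gain \<open>- 4 * v * e * m x \<rho> * dens lam u x \<rho>\<close>
      covers the flux term produced by the \<open>\<rho>\<close>-derivative of the cutoff.\<close>
    have pt: "w' x \<rho> \<le> M * (cutoff x1 v e x \<rho> * dens lam u x \<rho>) + ?g \<rho>"
      if \<rho>: "\<rho> \<in> {- (1 / e)..1 / e}" for \<rho>
    proof -
      have "\<bar>e * \<rho>\<bar> \<le> 1" using \<rho> e by (auto simp: abs_le_iff field_simps)
      then have "\<bar>e * \<rho> * flux u x \<rho>\<bar> \<le> 1 * \<bar>flux u x \<rho>\<bar>"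
        unfolding abs_mult[of "e * \<rho>"] by (intro mult_right_mono) auto
      then have "e * \<rho> * flux u x \<rho> \<le> v * dens lam u x \<rho>" using v(2)[OF x, of \<rho>] by linarith
      then have 1: "4 * e * m x \<rho> * (e * \<rho> * flux u x \<rho>) \<le> 4 * e * m x \<rho> * (v * dens lam u x \<rho>)"
        using e m0 by (intro mult_left_mono) auto
      have "dens_x lam u x \<rho> * cutoff x1 v e x \<rho> \<le> (M * dens lam u x \<rho> + flux_rho u x \<rho>) * cutoff x1 v e x \<rho>"
        by (rule mult_right_mono[OF dens_x_le[OF u xI M]]) (simp add: cut)
      with 1 show ?thesis unfolding w'_def by (simp add: algebra_simps power2_eq_square)
    qed
    have "integral {- (1 / e)..1 / e} (w' x) \<le> M * W x + 0"
    proof (rule has_integral_le)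
      show "((\<lambda>\<rho>. M * (cutoff x1 v e x \<rho> * dens lam u x \<rho>) + ?g \<rho>) has_integral M * W x + 0)
        {- (1 / e)..1 / e}"
        by (intro has_integral_add has_integral_mult_right ww g)
      show "(w' x has_integral integral {- (1 / e)..1 / e} (w' x)) {- (1 / e)..1 / e}"
        unfolding w'_def dens_def dens_x_def cutoff_def m_def
        by (intro integrable_integral integrable_continuous_real continuous_intros uS[THEN sec] P[THEN sec]
            Q[THEN sec] smooth_on_strip_partial_x[OF P, THEN sec] smooth_on_strip_partial_x[OF Q, THEN sec])
    qed (use pt in auto)
    then show ?thesis by simp
  qed
  \<comment> \<open>Gronwall's argument with integrating factor
    \<open>exp (- M * x)\<close>.\<close>
  show ?thesis
  proof (rule nonincreasing_from_within_derivative[OF \<open>x1 \<le> x2\<close> order_refl])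
    fix x assume x: "x \<in> {x1..x2}"
    show "((\<lambda>x. exp (- M * x) * W x) has_real_derivative
      exp (- M * x) * (integral {- (1 / e)..1 / e} (w' x) - M * W x)) (at x within {x1..x2})"
      by (rule derivative_eq_intros Wder x refl)+ (simp add: algebra_simps)
  next
    fix x assume "x \<in> {x1<..<x2}"
    then show "exp (- M * x) * (integral {- (1 / e)..1 / e} (w' x) - M * W x) \<le> 0"
      using le[of x] by (simp add: mult_nonneg_nonpos)
  qed
qed

text \<open>The cutoff is removed by letting \<open>e\<close> tend to 0: at \<open>x1\<close> the
  truncated energies lie below the full one, and at \<open>x2\<close> Fatou's lemma gives
  integrability together with the bound. Decay in \<open>\<rho>\<close> at \<open>x2\<close> is thus
  a result of the estimate.\<close>

lemma energy_growth:
  assumes u: "solves u" and M: "growth_rate lam M" and lam: "0 \<le> lam"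
    and x12: "x1 \<in> I" "x2 \<in> I" "x1 \<le> x2" and int: "integrable lborel (dens lam u x1)"
  shows "integrable lborel (dens lam u x2)"
    and "exp (- M * x2) * integral\<^sup>L lborel (dens lam u x2) \<le> exp (- M * x1) * integral\<^sup>L lborel (dens lam u x1)"
proof -
  note uS = solves_smooth[OF u]
  obtain v where v: "v > 0" "\<And>u x \<rho>. x \<in> {x1..x2} \<Longrightarrow> \<bar>flux u x \<rho>\<bar> \<le> v * dens lam u x \<rho>"
    using flux_le_dens[OF x12 lam] by blast
  define e :: "nat \<Rightarrow> real" where "e n = 1 / real (Suc n)" for n
  have e: "e n > 0" for n by (simp add: e_def)
  have e_lim: "e \<longlonglongrightarrow> 0" unfolding e_def by (rule LIMSEQ_Suc[OF lim_1_over_n])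
  define w where "w n x \<rho> = cutoff x1 v (e n) x \<rho> * dens lam u x \<rho>" for n x \<rho>
  have w_cont: "continuous_on S (w n x)" if "x \<in> I" for n x S
    unfolding w_def cutoff_def by (intro continuous_intros dens_continuous[OF uS that])
  have w_vanish: "w n x \<rho> = 0" if "x1 \<le> x" "\<rho> \<notin> {- (1 / e n)..1 / e n}" for n x \<rho>
  proof -
    have "e n * \<rho> < -1 \<or> 1 < e n * \<rho>" using that(2) e[of n] by (auto simp: field_simps)
    then have "\<bar>e n * \<rho>\<bar> \<ge> 1" by linarith
    then have "1 \<le> (e n * \<rho>)\<^sup>2" using one_le_power[of "\<bar>e n * \<rho>\<bar>" 2] by simp
    moreover have "0 \<le> 2 * v * e n * (x - x1)" using v e[of n] that by simp
    ultimately show ?thesis unfolding w_def cutoff_def by (simp add: power_mult_distrib max_def)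
  qed
  have w0: "0 \<le> w n x2 \<rho>" for n \<rho>
    unfolding w_def cutoff_def using dens_lower_bounds(5)[OF x12(2) lam] by simp
  have w_int: "integrable lborel (w n x2)"
      and w_eq: "integral\<^sup>L lborel (w n x2) = integral {- (1 / e n)..1 / e n} (w n x2)" for n
    using integrable_continuous_vanishing_outside[of "- (1 / e n)" "1 / e n" "w n x2"]
      w_cont[OF x12(2)] w_vanish[OF x12(3)] by blast+
  \<comment> \<open>Fatou's lemma wants a bound on the integrals themselves, so the exponential at
    \<open>x2\<close> is moved to the right.\<close>
  let ?B = "exp (M * x2) * (exp (- M * x1) * integral\<^sup>L lborel (dens lam u x1))"
  have bnd: "integral\<^sup>L lborel (w n x2) \<le> ?B" for n
  proof -
    have "exp (- M * x2) * integral {- (1 / e n)..1 / e n} (w n x2)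
        \<le> exp (- M * x1) * integral {- (1 / e n)..1 / e n} (w n x1)"
      unfolding w_def by (rule cutoff_energy_decreasing[OF u M lam x12 v(1) v(2) e]) auto
    also have "\<dots> \<le> exp (- M * x1) * integral\<^sup>L lborel (dens lam u x1)"
    proof (intro mult_left_mono integral_Icc_le_lborel int w_cont x12)
      fix \<rho>
      show "0 \<le> dens lam u x1 \<rho>" using dens_lower_bounds(5)[OF x12(1) lam] .
      moreover have "cutoff x1 v (e n) x1 \<rho> \<le> 1" by (simp add: cutoff_def power_le_one_iff)
      ultimately show "w n x1 \<rho> \<le> dens lam u x1 \<rho>"
        unfolding w_def by (simp add: mult_left_le_one_le cutoff_def)
    qed simp
    finally have "exp (M * x2) * (exp (- M * x2) * integral {- (1 / e n)..1 / e n} (w n x2)) \<le> ?B"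
      by (intro mult_left_mono) auto
    then show ?thesis by (simp add: w_eq mult.assoc[symmetric] exp_add[symmetric])
  qed
  have lim: "(\<lambda>n. w n x2 \<rho>) \<longlonglongrightarrow> dens lam u x2 \<rho>" for \<rho>
  proof -
    have "(\<lambda>n. cutoff x1 v (e n) x2 \<rho> * dens lam u x2 \<rho>) \<longlonglongrightarrow>
      (max 0 (1 - 2 * v * 0 * (x2 - x1) - 0\<^sup>2 * \<rho>\<^sup>2))\<^sup>2 * dens lam u x2 \<rho>"
      unfolding cutoff_def by (intro tendsto_intros e_lim)
    then show ?thesis unfolding w_def by simp
  qed
  show "integrable lborel (dens lam u x2)"
    by (rule Fatou_bounded_integrals(1)[OF w_int w0 lim bnd])
  have "integral\<^sup>L lborel (dens lam u x2) \<le> ?B"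
    by (rule Fatou_bounded_integrals(2)[OF w_int w0 lim bnd])
  then have "exp (- M * x2) * integral\<^sup>L lborel (dens lam u x2) \<le> exp (- M * x2) * ?B"
    by (intro mult_left_mono) auto
  then show "exp (- M * x2) * integral\<^sup>L lborel (dens lam u x2) \<le> exp (- M * x1) * integral\<^sup>L lborel (dens lam u x1)"
    by (simp add: mult.assoc[symmetric] exp_add[symmetric])
qed

section \<open>Energy bounds and limits up to the degenerate end\<close>

text \<open>All positive \<open>lam\<close> are included because the case \<open>lam = 0\<close> is
  reached through two different positive values.\<close>

definition finite_initial_energy :: "(real \<Rightarrow> real \<Rightarrow> real) \<Rightarrow> bool" where
  "finite_initial_energy u \<longleftrightarrow> (\<forall>lam>0. integrable lborel (dens lam u xi))"

lemma xi_in_I: "xi \<in> I"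
  using xi_less_xc by simp

lemma dens_integrable:
  assumes "solves u" "finite_initial_energy u" "lam > 0" "x \<in> I"
  shows "integrable lborel (dens lam u x)"
proof -
  obtain M where "growth_rate lam M" using growth_rate_exists[OF assms(3)] .
  from energy_growth(1)[OF assms(1) this _ xi_in_I assms(4)] show ?thesis
    using assms unfolding finite_initial_energy_def by auto
qed

text \<open>The density is affine in \<open>lam\<close>, so the value at 0, for which
  \<open>growth_rate_exists\<close> supplies no rate, is extrapolated from the values at 1 and
  2.\<close>

lemma dens_zero_integral:
  assumes "solves u" "finite_initial_energy u" "x \<in> I"
  shows "integrable lborel (dens 0 u x)"
    and "integral\<^sup>L lborel (dens 0 u x) = 2 * integral\<^sup>L lborel (dens 1 u x) - integral\<^sup>L lborel (dens 2 u x)"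
proof -
  have i: "integrable lborel (dens 1 u x)" "integrable lborel (dens 2 u x)"
    using dens_integrable[OF assms(1,2) _ assms(3)] by simp_all
  have eq: "dens 0 u x = (\<lambda>\<rho>. 2 * dens 1 u x \<rho> - dens 2 u x \<rho>)"
    by (auto simp: dens_def algebra_simps)
  show "integrable lborel (dens 0 u x)" unfolding eq using i by auto
  show "integral\<^sup>L lborel (dens 0 u x) = 2 * integral\<^sup>L lborel (dens 1 u x) - integral\<^sup>L lborel (dens 2 u x)"
    unfolding eq using i by simp
qed

text \<open>One growth rate is valid on all of \<open>I\<close>, so the energy grows at most by the
  finite factor \<open>exp (M * (xc - xi))\<close>, which does not depend on the solution.\<close>

lemma uniform_energy_bound:
  obtains C where "C > 0"
    "\<And>u x. solves u \<Longrightarrow> finite_initial_energy u \<Longrightarrow> x \<in> I \<Longrightarrow>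
      integral\<^sup>L lborel (dens 1 u x) \<le> C * integral\<^sup>L lborel (dens 1 u xi)"
proof -
  obtain M where M: "growth_rate 1 M" using growth_rate_exists[of 1] by auto
  then have M0: "0 \<le> M" unfolding growth_rate_def by blast
  have "integral\<^sup>L lborel (dens 1 u x) \<le> exp (M * (xc - xi)) * integral\<^sup>L lborel (dens 1 u xi)"
    if u: "solves u" "finite_initial_energy u" and x: "x \<in> I" for u x
  proof -
    have nonneg: "0 \<le> integral\<^sup>L lborel (dens 1 u xi)"
      using dens_lower_bounds(5)[OF xi_in_I, of 1] by simp
    have "exp (- M * x) * integral\<^sup>L lborel (dens 1 u x) \<le> exp (- M * xi) * integral\<^sup>L lborel (dens 1 u xi)"
      using energy_growth(2)[OF u(1) M _ xi_in_I x] u(2) x unfolding finite_initial_energy_def by auto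
    then have "exp (M * x) * (exp (- M * x) * integral\<^sup>L lborel (dens 1 u x))
        \<le> exp (M * x) * (exp (- M * xi) * integral\<^sup>L lborel (dens 1 u xi))"
      by (intro mult_left_mono) auto
    then have "integral\<^sup>L lborel (dens 1 u x) \<le> exp (M * (x - xi)) * integral\<^sup>L lborel (dens 1 u xi)"
      by (simp add: mult.assoc[symmetric] exp_add[symmetric] right_diff_distrib)
    also have "\<dots> \<le> exp (M * (xc - xi)) * integral\<^sup>L lborel (dens 1 u xi)"
      using nonneg M0 x by (intro mult_right_mono) (auto intro: mult_left_mono)
    finally show ?thesis .
  qed
  then show thesis by (intro that[of "exp (M * (xc - xi))"]) auto
qed

text \<open>The energy times \<open>exp (- M * x)\<close> is nonincreasing and nonnegative, hence
  converges; multiplying by the continuous function \<open>exp (M * x)\<close> restores the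
  energy.\<close>

lemma energy_tendsto:
  assumes u: "solves u" "finite_initial_energy u" and lam: "lam > 0"
  obtains L where "((\<lambda>x. integral\<^sup>L lborel (dens lam u x)) \<longlongrightarrow> L) (at_left xc)"
proof -
  obtain M where M: "growth_rate lam M" using growth_rate_exists[OF lam] .
  let ?K = "\<lambda>x. exp (- M * x) * integral\<^sup>L lborel (dens lam u x)"
  obtain L where L: "(?K \<longlongrightarrow> L) (at_left xc)"
  proof (rule antimono_bounded_below_tendsto_at_left[OF xi_less_xc, of ?K 0])
    show "?K y \<le> ?K x" if "xi \<le> x" "x \<le> y" "y < xc" for x y
      using energy_growth(2)[OF u(1) M _ _ _ that(2)] dens_integrable[OF u lam] lam that by auto
    show "0 \<le> ?K x" if "xi \<le> x" "x < xc" for x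
      using dens_lower_bounds(5)[of x lam] that lam by simp
  qed blast
  have "((\<lambda>x. exp (M * x) * ?K x) \<longlongrightarrow> exp (M * xc) * L) (at_left xc)"
    by (intro tendsto_intros L)
  then have "((\<lambda>x. integral\<^sup>L lborel (dens lam u x)) \<longlongrightarrow> exp (M * xc) * L) (at_left xc)"
    by (simp add: mult.assoc[symmetric] exp_add[symmetric])
  then show thesis by (rule that)
qed

text \<open>Monotonicity holds only for the energies with \<open>lam > 0\<close>; the energy with \<open>lam = 0\<close> converges as
  a linear combination of two of them.\<close>

lemma dens_zero_tendsto:
  assumes u: "solves u" "finite_initial_energy u"
  obtains L where "((\<lambda>x. integral\<^sup>L lborel (dens 0 u x)) \<longlongrightarrow> L) (at_left xc)"
proof -
  obtain L1 where 1: "((\<lambda>x. integral\<^sup>L lborel (dens 1 u x)) \<longlongrightarrow> L1) (at_left xc)"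
    using energy_tendsto[OF u zero_less_one] .
  obtain L2 where 2: "((\<lambda>x. integral\<^sup>L lborel (dens 2 u x)) \<longlongrightarrow> L2) (at_left xc)"
    using energy_tendsto[OF u zero_less_numeral] .
  have "((\<lambda>x. 2 * integral\<^sup>L lborel (dens 1 u x) - integral\<^sup>L lborel (dens 2 u x)) \<longlongrightarrow> 2 * L1 - L2) (at_left xc)"
    by (intro tendsto_intros 1 2)
  then have "((\<lambda>x. integral\<^sup>L lborel (dens 0 u x)) \<longlongrightarrow> 2 * L1 - L2) (at_left xc)"
  proof (rule Lim_transform_eventually)
    show "\<forall>\<^sub>F x in at_left xc. 2 * integral\<^sup>L lborel (dens 1 u x) - integral\<^sup>L lborel (dens 2 u x)
      = integral\<^sup>L lborel (dens 0 u x)"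
      using eventually_at_left_real[OF xi_less_xc]
      by eventually_elim (use dens_zero_integral(2)[OF u] in auto)
  qed
  then show thesis by (rule that)
qed

section \<open>Boundary values at the degenerate end\<close>

text \<open>Coercivity applied to \<open>- a'\<close> gives a differential inequality for
  \<open>- a\<close>. With the weight \<open>exp (- K * x)\<close> its derivative is at most a
  negative constant, and integration from \<open>x\<close> to \<open>xc\<close>, where
  \<open>a\<close> vanishes, gives the linear lower bound.\<close>

lemma linear_degeneration:
  obtains k where "k > 0" "\<And>x. x \<in> I \<Longrightarrow> k * (xc - x) \<le> - a x"
proof -
  obtain d K where d: "d > 0" and K: "K > 0"
    and co: "\<And>x. x \<in> {xi..xc} \<Longrightarrow> - a' x \<le> - d + K * - a x"
  proof (rule negative_at_zero_imp_coercive[OF xi_less_xc, of "\<lambda>x. - a' x" "\<lambda>x. - a x"])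
    show "continuous_on {xi..xc} (\<lambda>x. - a' x)" "continuous_on {xi..xc} (\<lambda>x. - a x)"
      by (intro continuous_intros coeffs_continuous a_cont)+
  qed (use a_neg a_end a'_end in auto)
  \<comment> \<open>The minimum of \<open>d * exp (- K * y)\<close> over
    \<open>y \<le> xc\<close>.\<close>
  define k where "k = d * exp (- K * xc)"
  have k: "k > 0" using d by (simp add: k_def)
  have le: "k * (xc - x) \<le> - a x * exp (- K * x)" if x: "x \<in> I" for x
  proof -
    have sub: "{x..xc} \<subseteq> {xi..xc}" using x by auto
    have "- a xc * exp (- K * xc) + k * xc \<le> - a x * exp (- K * x) + k * x"
    proof (rule nonincreasing_from_within_derivative[OF _ sub])
      show "x \<le> xc" using x by simp
    next
      fix y assume y: "y \<in> {x..xc}"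
      then have y': "y \<in> {xi..xc}" using sub by auto
      show "((\<lambda>y. - a y * exp (- K * y) + k * y) has_real_derivative
        (- a' y - K * - a y) * exp (- K * y) + k) (at y within {xi..xc})"
        by (rule derivative_eq_intros a_deriv[OF y'] refl)+ (simp add: algebra_simps)
    next
      fix y assume y: "y \<in> {x<..<xc}"
      then have y': "y \<in> {xi..xc}" using sub by auto
      have "(- a' y - K * - a y) * exp (- K * y) \<le> - d * exp (- K * y)"
        using co[OF y'] by (intro mult_right_mono) auto
      also have "\<dots> \<le> - k"
        unfolding k_def using d K y by auto
      finally show "(- a' y - K * - a y) * exp (- K * y) + k \<le> 0" by simp
    qed
    then show ?thesis using a_end by (simp add: right_diff_distrib)
  qed
  \<comment> \<open>The weight is removed by multiplying with \<open>exp (K * x)\<close>, which is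
    at least \<open>exp (K * xi)\<close> on \<open>I\<close>; this factor enters the
    witness.\<close>
  show thesis
  proof (rule that[of "k * exp (K * xi)"])
    fix x assume x: "x \<in> I"
    have "exp (K * xi) * (k * (xc - x)) \<le> exp (K * x) * (- a x * exp (- K * x))"
      by (rule mult_mono[OF _ le[OF x]]) (use x K k in auto)
    also have "\<dots> = - a x" by (simp add: mult.left_commute exp_add[symmetric])
    finally show "k * exp (K * xi) * (xc - x) \<le> - a x" by (simp add: mult_ac)
  qed (use k in auto)
qed

lemma partial_x_square_integral:
  assumes u: "solves u" "finite_initial_energy u" and x: "x \<in> I"
  shows "integrable lborel (\<lambda>\<rho>. (partial_x I u x \<rho>)\<^sup>2)"
    and "- a x * (LINT \<rho>|lborel. (partial_x I u x \<rho>)\<^sup>2) \<le> integral\<^sup>L lborel (dens 1 u x)"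
proof -
  have i: "integrable lborel (dens 1 u x)" using dens_integrable[OF u _ x] by simp
  have ax: "- a x > 0" using a_neg[OF x] by simp
  have le: "- a x * (partial_x I u x \<rho>)\<^sup>2 \<le> dens 1 u x \<rho>" for \<rho>
    using dens_lower_bounds(1)[OF x, of 1] by simp
  have "continuous_on UNIV (\<lambda>\<rho>. - a x * (partial_x I u x \<rho>)\<^sup>2)"
    by (intro continuous_intros smooth_on_strip_continuous_section[OF smooth_on_strip_partial_x[OF solves_smooth[OF u(1)]] x])
  from borel_measurable_continuous_onI[OF this]
  have m: "(\<lambda>\<rho>. - a x * (partial_x I u x \<rho>)\<^sup>2) \<in> borel_measurable lborel" by simp
  have j: "integrable lborel (\<lambda>\<rho>. - a x * (partial_x I u x \<rho>)\<^sup>2)"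
    by (rule Bochner_Integration.integrable_bound[OF i m])
      (use le ax dens_lower_bounds(5)[OF x, of 1] in \<open>auto simp: abs_mult\<close>)
  then show int: "integrable lborel (\<lambda>\<rho>. (partial_x I u x \<rho>)\<^sup>2)" using ax by simp
  show "- a x * (LINT \<rho>|lborel. (partial_x I u x \<rho>)\<^sup>2) \<le> integral\<^sup>L lborel (dens 1 u x)"
    using integral_mono[OF j i le] by simp
qed

text \<open>The Sobolev inequality is applied to the section of \<open>u\<^sub>x\<close>. Its
  \<open>\<rho>\<close>-derivative is the \<open>x\<close>-derivative of the solution
  \<open>u\<^sub>\<rho>\<close>, so after multiplication by \<open>- a x\<close> both integrals are
  bounded by energies; the linear lower bound for \<open>- a\<close> then gives the rate.\<close>

lemma partial_x_sup_bound:
  assumes u: "solves u" "finite_initial_energy u" "finite_initial_energy (partial_rho u)"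
  obtains D where "D \<ge> 0" "\<And>x \<rho>. x \<in> I \<Longrightarrow> \<bar>partial_x I u x \<rho>\<bar> \<le> D / sqrt (xc - x)"
proof -
  note uS = solves_smooth[OF u(1)] and v = solves_partial_rho[OF u(1)]
  obtain C where C: "C > 0" "\<And>u x. solves u \<Longrightarrow> finite_initial_energy u \<Longrightarrow> x \<in> I \<Longrightarrow>
      integral\<^sup>L lborel (dens 1 u x) \<le> C * integral\<^sup>L lborel (dens 1 u xi)"
    using uniform_energy_bound by blast
  obtain k where k: "k > 0" "\<And>x. x \<in> I \<Longrightarrow> k * (xc - x) \<le> - a x"
    using linear_degeneration by blast
  \<comment> \<open>The weights 2 and 1 are those of the Sobolev inequality.\<close>
  define B where "B = 2 * (C * integral\<^sup>L lborel (dens 1 u xi)) + C * integral\<^sup>L lborel (dens 1 (partial_rho u) xi)"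
  have B0: "B \<ge> 0"
    unfolding B_def using C(1) dens_lower_bounds(5)[OF xi_in_I, of 1] by simp
  have bound: "\<bar>partial_x I u x \<rho>\<bar> \<le> sqrt (B / k) / sqrt (xc - x)" if x: "x \<in> I" for x \<rho>
  proof -
    let ?P = "partial_x I u x" and ?P' = "partial_x I (partial_rho u) x"
    have PS: "smooth_on_strip I (partial_x I u)" by (rule smooth_on_strip_partial_x[OF uS])
    have ax: "- a x > 0" using a_neg[OF x] by simp
    have "(?P \<rho>)\<^sup>2 \<le> 2 * (LINT r|lborel. (?P r)\<^sup>2) + (LINT r|lborel. (?P' r)\<^sup>2)"
    proof (rule sobolev_sup_bound)
      show "(?P has_real_derivative ?P' r) (at r)" for r
        using smooth_on_strip_has_partial_rho[OF PS x] mixed_partials_commute[OF uS x] by simp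
      show "continuous_on UNIV ?P'"
        by (rule smooth_on_strip_continuous_section[OF _ x])
          (intro smooth_on_strip_partial_x smooth_on_strip_partial_rho uS)
    qed (rule partial_x_square_integral(1)[OF u(1,2) x] partial_x_square_integral(1)[OF v u(3) x])+
    then have "- a x * (?P \<rho>)\<^sup>2 \<le> - a x * (2 * (LINT r|lborel. (?P r)\<^sup>2) + (LINT r|lborel. (?P' r)\<^sup>2))"
      using ax by (intro mult_left_mono) auto
    also have "\<dots> = 2 * (- a x * (LINT r|lborel. (?P r)\<^sup>2)) + - a x * (LINT r|lborel. (?P' r)\<^sup>2)"
      by (simp add: algebra_simps)
    also have "\<dots> \<le> B"
      unfolding B_def
      using partial_x_square_integral(2)[OF u(1,2) x] partial_x_square_integral(2)[OF v u(3) x]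
        C(2)[OF u(1,2) x] C(2)[OF v u(3) x] by linarith
    finally have aP: "- a x * (?P \<rho>)\<^sup>2 \<le> B" .
    have "k * (xc - x) * (?P \<rho>)\<^sup>2 \<le> - a x * (?P \<rho>)\<^sup>2"
      by (rule mult_right_mono[OF k(2)[OF x]]) simp
    with aP have "k * (xc - x) * (?P \<rho>)\<^sup>2 \<le> B" by linarith
    then have "(?P \<rho>)\<^sup>2 \<le> B / k / (xc - x)" using k(1) x by (simp add: field_simps)
    then show ?thesis
      using real_sqrt_le_mono[of "(?P \<rho>)\<^sup>2" "B / k / (xc - x)"] by (simp add: real_sqrt_divide real_sqrt_mult)
  qed
  show thesis by (rule that[OF _ bound]) (use B0 k in auto)
qed

text \<open>The bound \<open>D / sqrt (xc - x)\<close> is minus the derivative of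
  \<open>2 * D * sqrt (xc - x)\<close>, so adding this function to \<open>u\<close> or to
  \<open>- u\<close> gives something nonincreasing in \<open>x\<close>. The limit exists by
  monotonicity, and the rate is uniform in \<open>\<rho>\<close>, as differentiation of the limit
  will require.\<close>

lemma trace_exists:
  assumes u: "solves u" "finite_initial_energy u" "finite_initial_energy (partial_rho u)"
  obtains D uc where "D \<ge> 0" "\<forall>\<rho>. ((\<lambda>x. u x \<rho>) \<longlongrightarrow> uc \<rho>) (at_left xc)"
    "\<forall>x\<in>I. \<forall>\<rho>. \<bar>u x \<rho> - uc \<rho>\<bar> \<le> D * sqrt (xc - x)"
proof -
  note uS = solves_smooth[OF u(1)]
  obtain D where D: "D \<ge> 0" "\<And>x \<rho>. x \<in> I \<Longrightarrow> \<bar>partial_x I u x \<rho>\<bar> \<le> D / sqrt (xc - x)"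
    using partial_x_sup_bound[OF u] by blast
  have sq: "((\<lambda>x. sqrt (xc - x)) \<longlongrightarrow> 0) (at_left xc)"
    by (rule tendsto_eq_intros refl)+ simp
  \<comment> \<open>The sign \<open>s\<close> is 1 or -1; the two cases give the two halves of the
    absolute value in \<open>diff\<close>.\<close>
  have anti: "s * u y \<rho> + 2 * D * sqrt (xc - y) \<le> s * u x \<rho> + 2 * D * sqrt (xc - x)"
    if "xi \<le> x" "x \<le> y" "y < xc" "\<bar>s\<bar> = 1" for s x y \<rho>
  proof (rule nonincreasing_from_within_derivative[OF \<open>x \<le> y\<close>])
    show "{x..y} \<subseteq> I" using that by auto
  next
    fix z assume z: "z \<in> {x..y}"
    then have zI: "z \<in> I" and pos: "xc - z > 0" using that by auto
    have 1: "((\<lambda>z. s * u z \<rho>) has_real_derivative s * partial_x I u z \<rho>) (at z within I)"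
      by (rule DERIV_cmult[OF smooth_on_strip_has_partial_x[OF uS zI]])
    have 2: "((\<lambda>z. 2 * D * sqrt (xc - z)) has_real_derivative - (D / sqrt (xc - z))) (at z within I)"
      using pos by (auto intro!: derivative_eq_intros simp: field_simps)
    show "((\<lambda>z. s * u z \<rho> + 2 * D * sqrt (xc - z)) has_real_derivative
      s * partial_x I u z \<rho> + - (D / sqrt (xc - z))) (at z within I)"
      by (rule DERIV_add[OF 1 2])
  next
    fix z assume z: "z \<in> {x<..<y}"
    then have zI: "z \<in> I" using that by auto
    have "s * partial_x I u z \<rho> \<le> \<bar>s * partial_x I u z \<rho>\<bar>" by simp
    also have "\<dots> \<le> D / sqrt (xc - z)" using D(2)[OF zI] that by (simp add: abs_mult)
    finally show "s * partial_x I u z \<rho> + - (D / sqrt (xc - z)) \<le> 0" by simp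
  qed
  have diff: "\<bar>u x \<rho> - u y \<rho>\<bar> \<le> 2 * D * sqrt (xc - x)" if "xi \<le> x" "x \<le> y" "y < xc" for x y \<rho>
  proof -
    have "0 \<le> 2 * D * sqrt (xc - y)" using D that by simp
    then show ?thesis using anti[OF that, of 1 \<rho>] anti[OF that, of "-1" \<rho>] by (simp add: abs_le_iff)
  qed
  have "\<exists>L. ((\<lambda>x. u x \<rho>) \<longlongrightarrow> L) (at_left xc)" for \<rho>
  proof -
    obtain L where L: "((\<lambda>x. 1 * u x \<rho> + 2 * D * sqrt (xc - x)) \<longlongrightarrow> L) (at_left xc)"
    proof (rule antimono_bounded_below_tendsto_at_left[OF xi_less_xc,
          of "\<lambda>x. 1 * u x \<rho> + 2 * D * sqrt (xc - x)" "u xi \<rho> - 2 * D * sqrt (xc - xi)"])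
      show "1 * u y \<rho> + 2 * D * sqrt (xc - y) \<le> 1 * u x \<rho> + 2 * D * sqrt (xc - x)"
        if "xi \<le> x" "x \<le> y" "y < xc" for x y
        by (rule anti[OF that]) simp
      show "u xi \<rho> - 2 * D * sqrt (xc - xi) \<le> 1 * u x \<rho> + 2 * D * sqrt (xc - x)" if "xi \<le> x" "x < xc" for x
      proof -
        have "0 \<le> 2 * D * sqrt (xc - x)" using D that by simp
        then show ?thesis using diff[OF order_refl that, of \<rho>] by (simp add: abs_le_iff)
      qed
    qed blast
    have "((\<lambda>x. (1 * u x \<rho> + 2 * D * sqrt (xc - x)) - 2 * D * sqrt (xc - x)) \<longlongrightarrow> L - 2 * D * 0) (at_left xc)"
      by (intro tendsto_diff tendsto_mult_left L sq)
    then show ?thesis by auto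
  qed
  then obtain uc where uc: "\<And>\<rho>. ((\<lambda>x. u x \<rho>) \<longlongrightarrow> uc \<rho>) (at_left xc)" by metis
  \<comment> \<open>Letting \<open>y\<close> tend to \<open>xc\<close> in the Cauchy estimate
    \<open>diff\<close> turns it into a rate of convergence.\<close>
  have "\<bar>u x \<rho> - uc \<rho>\<bar> \<le> 2 * D * sqrt (xc - x)" if x: "x \<in> I" for x \<rho>
  proof (rule tendsto_upperbound)
    show "((\<lambda>y. \<bar>u x \<rho> - u y \<rho>\<bar>) \<longlongrightarrow> \<bar>u x \<rho> - uc \<rho>\<bar>) (at_left xc)"
      by (intro tendsto_intros uc)
    have "x < xc" using x by simp
    then show "\<forall>\<^sub>F y in at_left xc. \<bar>u x \<rho> - u y \<rho>\<bar> \<le> 2 * D * sqrt (xc - x)"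
      by (rule eventually_mono[OF eventually_at_left_real]) (use x diff in auto)
  qed simp
  then show thesis using that[of "2 * D" uc] D(1) uc by auto
qed

text \<open>Fatou's lemma and the theorem on derivatives of limits are used for sequences, so the
  left limit is taken along one.\<close>

lemma sequence_to_xc:
  obtains X where "\<forall>n. X n \<in> I" "filterlim X (at_left xc) sequentially"
proof -
  define X where "X n = xc - (xc - xi) * inverse (real (Suc n))" for n
  have pos: "0 < (xc - xi) * inverse (real (Suc n))" for n
    using xi_less_xc by simp
  have "inverse (real (Suc n)) \<le> 1" for n by (simp add: field_simps)
  then have le: "(xc - xi) * inverse (real (Suc n)) \<le> (xc - xi) * 1" for n
    using xi_less_xc by (intro mult_left_mono) auto
  have X: "X n \<in> I" for n
  proof -
    have "xc - t \<in> I" if "0 < t" "t \<le> (xc - xi) * 1" for t using that by simp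
    from this[OF pos le] show ?thesis unfolding X_def .
  qed
  have "X \<longlonglongrightarrow> xc - (xc - xi) * 0"
    unfolding X_def by (intro tendsto_intros LIMSEQ_inverse_real_of_nat)
  then have "filterlim X (at_left xc) sequentially"
    using X by (auto simp: filterlim_at less_imp_neq)
  with X that show thesis by blast
qed

text \<open>The trace of \<open>u\<^sub>\<rho>\<close> is attained at a rate uniform in
  \<open>\<rho>\<close>, and uniform convergence of derivatives allows the limit to be
  differentiated. Applying the trace result to \<open>u\<^sub>\<rho>\<close> is what brings in the
  initial energy of \<open>u\<^sub>\<rho>\<^sub>\<rho>\<close>.\<close>

lemma differentiable_trace_exists:
  assumes u: "solves u" "finite_initial_energy u" "finite_initial_energy (partial_rho u)"
    "finite_initial_energy (partial_rho (partial_rho u))"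
  obtains uc uc_rho where "\<forall>\<rho>. ((\<lambda>x. u x \<rho>) \<longlongrightarrow> uc \<rho>) (at_left xc)"
    "\<forall>\<rho>. ((\<lambda>x. partial_rho u x \<rho>) \<longlongrightarrow> uc_rho \<rho>) (at_left xc)"
    "\<forall>\<rho>. (uc has_real_derivative uc_rho \<rho>) (at \<rho>)"
proof -
  note uS = solves_smooth[OF u(1)] and v = solves_partial_rho[OF u(1)]
  obtain uc where uc: "\<forall>\<rho>. ((\<lambda>x. u x \<rho>) \<longlongrightarrow> uc \<rho>) (at_left xc)"
    using trace_exists[OF u(1-3)] by metis
  obtain uc_rho D where D: "D \<ge> 0" and uc_rho: "\<forall>\<rho>. ((\<lambda>x. partial_rho u x \<rho>) \<longlongrightarrow> uc_rho \<rho>) (at_left xc)"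
    and rate: "\<forall>x\<in>I. \<forall>\<rho>. \<bar>partial_rho u x \<rho> - uc_rho \<rho>\<bar> \<le> D * sqrt (xc - x)"
    using trace_exists[OF v u(3,4)] .
  obtain X where X: "\<forall>n. X n \<in> I" and X_lim: "filterlim X (at_left xc) sequentially"
    using sequence_to_xc .
  note X = X[rule_format]
  have ucX: "(\<lambda>n. u (X n) \<rho>) \<longlonglongrightarrow> uc \<rho>" for \<rho>
    by (rule filterlim_compose[OF uc[rule_format] X_lim])
  have "\<exists>g. \<forall>\<rho>\<in>UNIV. (\<lambda>n. u (X n) \<rho>) \<longlonglongrightarrow> g \<rho> \<and> (g has_derivative (*) (uc_rho \<rho>)) (at \<rho> within UNIV)"
  proof (rule has_derivative_sequence)
    show "(u (X n) has_derivative (*) (partial_rho u (X n) \<rho>)) (at \<rho> within UNIV)" for n \<rho>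
      using smooth_on_strip_has_partial_rho[OF uS X] by (simp add: has_field_derivative_def)
    show "(\<lambda>n. u (X n) 0) \<longlonglongrightarrow> uc 0" by (rule ucX)
    fix e :: real assume e: "e > 0"
    have "((\<lambda>x. D * sqrt (xc - x)) \<longlongrightarrow> D * sqrt (xc - xc)) (at_left xc)"
      by (intro tendsto_intros)
    from filterlim_compose[OF this X_lim] have "(\<lambda>n. D * sqrt (xc - X n)) \<longlonglongrightarrow> 0" by simp
    then have "\<forall>\<^sub>F n in sequentially. D * sqrt (xc - X n) < e"
      using e by (rule order_tendstoD)
    then show "\<forall>\<^sub>F n in sequentially. \<forall>\<rho>\<in>UNIV. \<forall>k. norm (partial_rho u (X n) \<rho> * k - uc_rho \<rho> * k) \<le> e * norm k"
    proof eventually_elim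
      case (elim n)
      show ?case
      proof (intro ballI allI)
        fix \<rho> k
        have "\<bar>partial_rho u (X n) \<rho> - uc_rho \<rho>\<bar> \<le> e" using rate[rule_format, OF X, of n \<rho>] elim by linarith
        then have "\<bar>partial_rho u (X n) \<rho> - uc_rho \<rho>\<bar> * \<bar>k\<bar> \<le> e * \<bar>k\<bar>" by (intro mult_right_mono) auto
        then show "norm (partial_rho u (X n) \<rho> * k - uc_rho \<rho> * k) \<le> e * norm k"
          by (simp add: left_diff_distrib[symmetric] abs_mult)
      qed
    qed
  qed auto
  then obtain g where g: "\<And>\<rho>. (\<lambda>n. u (X n) \<rho>) \<longlonglongrightarrow> g \<rho>" "\<And>\<rho>. (g has_derivative (*) (uc_rho \<rho>)) (at \<rho>)"
    by auto
  \<comment> \<open>The theorem on sequences supplies some limit function; uniqueness of limits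
    identifies it with the trace.\<close>
  have "g = uc" using LIMSEQ_unique[OF g(1) ucX] by blast
  then have "\<forall>\<rho>. (uc has_real_derivative uc_rho \<rho>) (at \<rho>)"
    using g(2) by (simp add: has_field_derivative_def)
  then show thesis using that uc uc_rho by metis
qed

section \<open>Energy and trace under a common bound\<close>

text \<open>Values at \<open>xc\<close> are given by existential left limits because the solution
  lives only on \<open>x < xc\<close>.\<close>

definition energy_and_trace_le :: "(real \<Rightarrow> real \<Rightarrow> real) \<Rightarrow> real \<Rightarrow> bool" where
  "energy_and_trace_le u B \<longleftrightarrow>
    (\<forall>x\<in>I. integrable lborel (dens 0 u x) \<and> integral\<^sup>L lborel (dens 0 u x) \<le> B) \<and>
    (\<exists>Ec. ((\<lambda>x. integral\<^sup>L lborel (dens 0 u x)) \<longlongrightarrow> Ec) (at_left xc) \<and> Ec \<le> B) \<and>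
    (\<exists>uc uc_rho.
       (\<forall>\<rho>. ((\<lambda>x. u x \<rho>) \<longlongrightarrow> uc \<rho>) (at_left xc)) \<and>
       (\<forall>\<rho>. ((\<lambda>x. partial_rho u x \<rho>) \<longlongrightarrow> uc_rho \<rho>) (at_left xc)) \<and>
       (\<forall>\<rho>. (uc has_real_derivative uc_rho \<rho>) (at \<rho>)) \<and>
       integrable lborel (\<lambda>\<rho>. (uc \<rho>)\<^sup>2 + (uc_rho \<rho>)\<^sup>2) \<and>
       (LINT \<rho>|lborel. (uc \<rho>)\<^sup>2 + (uc_rho \<rho>)\<^sup>2) \<le> B)"

lemma energy_and_trace_bound:
  obtains C where "C > 0"
    "\<forall>u. solves u \<longrightarrow> finite_initial_energy u \<longrightarrow> finite_initial_energy (partial_rho u) \<longrightarrow>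
      finite_initial_energy (partial_rho (partial_rho u)) \<longrightarrow>
      energy_and_trace_le u (C * integral\<^sup>L lborel (dens 1 u xi))"
proof -
  obtain C where C: "C > 0" "\<And>u x. solves u \<Longrightarrow> finite_initial_energy u \<Longrightarrow> x \<in> I \<Longrightarrow>
      integral\<^sup>L lborel (dens 1 u x) \<le> C * integral\<^sup>L lborel (dens 1 u xi)"
    using uniform_energy_bound by blast
  obtain k where k: "k > 0" "\<And>x. x \<in> {xi..xc} \<Longrightarrow> k \<le> c x"
    using continuous_on_Icc_pos_lower_bound[OF c_cont c_pos] by blast
  \<comment> \<open>With \<open>lam = 1\<close> the density dominates \<open>u\<^sup>2\<close>, and
    it dominates \<open>k\<close> times \<open>u\<^sub>\<rho>\<^sup>2\<close>; hence the factor
    \<open>1 + 1 / k\<close> for the trace.\<close>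
  define C' where "C' = (1 + 1 / k) * C"
  have C': "C' > 0" "C \<le> C'" using C(1) k by (auto simp: C'_def add_pos_pos mult_pos_pos)
  show thesis
  proof (rule that[OF C'(1)], unfold energy_and_trace_le_def, intro allI impI conjI)
    fix u assume u: "solves u" "finite_initial_energy u" "finite_initial_energy (partial_rho u)"
      "finite_initial_energy (partial_rho (partial_rho u))"
    note uS = solves_smooth[OF u(1)]
    let ?E = "integral\<^sup>L lborel (dens 1 u xi)"
    have E0: "?E \<ge> 0" using dens_lower_bounds(5)[OF xi_in_I, of 1] by simp
    have i1: "integrable lborel (dens 1 u x)" if "x \<in> I" for x
      using dens_integrable[OF u(1,2) _ that] by simp
    have zero_le: "integral\<^sup>L lborel (dens 0 u x) \<le> C' * ?E" if x: "x \<in> I" for x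
    proof -
      have "integral\<^sup>L lborel (dens 0 u x) \<le> integral\<^sup>L lborel (dens 1 u x)"
        by (rule integral_mono[OF dens_zero_integral(1)[OF u(1,2) x] i1[OF x]])
          (simp add: dens_eq[of 1])
      also have "\<dots> \<le> C * ?E" by (rule C(2)[OF u(1,2) x])
      also have "\<dots> \<le> C' * ?E" using C' E0 by (intro mult_right_mono)
      finally show ?thesis .
    qed
    then show "\<forall>x\<in>I. integrable lborel (dens 0 u x) \<and> integral\<^sup>L lborel (dens 0 u x) \<le> C' * ?E"
      using dens_zero_integral(1)[OF u(1,2)] by blast
    obtain Ec where Ec: "((\<lambda>x. integral\<^sup>L lborel (dens 0 u x)) \<longlongrightarrow> Ec) (at_left xc)"
      using dens_zero_tendsto[OF u(1,2)] .
    moreover have "Ec \<le> C' * ?E"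
    proof (rule tendsto_upperbound[OF Ec])
      show "\<forall>\<^sub>F x in at_left xc. integral\<^sup>L lborel (dens 0 u x) \<le> C' * ?E"
        using eventually_at_left_real[OF xi_less_xc] by eventually_elim (use zero_le in auto)
    qed simp
    ultimately show "\<exists>Ec. ((\<lambda>x. integral\<^sup>L lborel (dens 0 u x)) \<longlongrightarrow> Ec) (at_left xc) \<and> Ec \<le> C' * ?E"
      by blast
    obtain uc uc_rho where uc: "\<forall>\<rho>. ((\<lambda>x. u x \<rho>) \<longlongrightarrow> uc \<rho>) (at_left xc)"
      "\<forall>\<rho>. ((\<lambda>x. partial_rho u x \<rho>) \<longlongrightarrow> uc_rho \<rho>) (at_left xc)"
      "\<forall>\<rho>. (uc has_real_derivative uc_rho \<rho>) (at \<rho>)"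
      using differentiable_trace_exists[OF u] .
    obtain X where X: "\<forall>n. X n \<in> I" and X_lim: "filterlim X (at_left xc) sequentially"
      using sequence_to_xc .
    note X = X[rule_format]
    define F where "F n \<rho> = (u (X n) \<rho>)\<^sup>2 + (partial_rho u (X n) \<rho>)\<^sup>2" for n \<rho>
    have F0: "0 \<le> F n \<rho>" for n \<rho> by (simp add: F_def)
    have F_le: "F n \<rho> \<le> (1 + 1 / k) * dens 1 u (X n) \<rho>" for n \<rho>
    proof -
      have Xn: "X n \<in> {xi..xc}" using X[of n] by auto
      have "k * (partial_rho u (X n) \<rho>)\<^sup>2 \<le> c (X n) * (partial_rho u (X n) \<rho>)\<^sup>2"
        by (rule mult_right_mono[OF k(2)[OF Xn]]) simp
      also have "\<dots> \<le> dens 1 u (X n) \<rho>" using dens_lower_bounds(2)[OF X, of 1] by simp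
      finally have "(partial_rho u (X n) \<rho>)\<^sup>2 \<le> dens 1 u (X n) \<rho> / k"
        using k(1) by (simp add: field_simps)
      moreover have "(u (X n) \<rho>)\<^sup>2 \<le> dens 1 u (X n) \<rho>" using dens_lower_bounds(3)[OF X, of 1] by simp
      ultimately show ?thesis by (simp add: F_def distrib_right)
    qed
    have int: "integrable lborel (\<lambda>\<rho>. (1 + 1 / k) * dens 1 u (X n) \<rho>)" for n
      using i1[OF X] by simp
    have F_int: "integrable lborel (F n)" for n
    proof (rule Bochner_Integration.integrable_bound[OF int])
      have "continuous_on UNIV (F n)"
        unfolding F_def
        by (intro continuous_intros smooth_on_strip_continuous_section[OF uS X]
            smooth_on_strip_continuous_section[OF smooth_on_strip_partial_rho[OF uS] X])
      from borel_measurable_continuous_onI[OF this] show "F n \<in> borel_measurable lborel" by simp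
      show "AE \<rho> in lborel. norm (F n \<rho>) \<le> norm ((1 + 1 / k) * dens 1 u (X n) \<rho>)"
      proof (rule AE_I2)
        fix \<rho>
        show "norm (F n \<rho>) \<le> norm ((1 + 1 / k) * dens 1 u (X n) \<rho>)"
          using F0[of n \<rho>] F_le[of n \<rho>] by simp
      qed
    qed
    have F_lim: "(\<lambda>n. F n \<rho>) \<longlonglongrightarrow> (uc \<rho>)\<^sup>2 + (uc_rho \<rho>)\<^sup>2" for \<rho>
      unfolding F_def
      by (intro tendsto_intros filterlim_compose[OF uc(1)[rule_format] X_lim] filterlim_compose[OF uc(2)[rule_format] X_lim])
    have F_bnd: "integral\<^sup>L lborel (F n) \<le> C' * ?E" for n
    proof -
      have "integral\<^sup>L lborel (F n) \<le> (1 + 1 / k) * integral\<^sup>L lborel (dens 1 u (X n))"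
        using integral_mono[OF F_int int F_le] by simp
      also have "\<dots> \<le> (1 + 1 / k) * (C * ?E)"
        using C(2)[OF u(1,2) X] k by (intro mult_left_mono) auto
      finally show ?thesis by (simp add: C'_def mult.assoc)
    qed
    note Fatou = Fatou_bounded_integrals[OF F_int F0 F_lim F_bnd]
    show "\<exists>uc uc_rho.
         (\<forall>\<rho>. ((\<lambda>x. u x \<rho>) \<longlongrightarrow> uc \<rho>) (at_left xc)) \<and>
         (\<forall>\<rho>. ((\<lambda>x. partial_rho u x \<rho>) \<longlongrightarrow> uc_rho \<rho>) (at_left xc)) \<and>
         (\<forall>\<rho>. (uc has_real_derivative uc_rho \<rho>) (at \<rho>)) \<and>
         integrable lborel (\<lambda>\<rho>. (uc \<rho>)\<^sup>2 + (uc_rho \<rho>)\<^sup>2) \<and>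
         (LINT \<rho>|lborel. (uc \<rho>)\<^sup>2 + (uc_rho \<rho>)\<^sup>2) \<le> C' * ?E"
      using uc Fatou by blast
  qed
qed

section \<open>Energies of the initial data\<close>

text \<open>Because mixed partials commute also at the closed end, passing from \<open>u\<close> to
  \<open>u\<^sub>\<rho>\<close> differentiates both initial data in \<open>\<rho>\<close>.\<close>

lemma partial_rho_initial_data:
  assumes "smooth_on_strip I u"
  shows "partial_rho u xi = deriv (u xi)"
    and "partial_x I (partial_rho u) xi = deriv (partial_x I u xi)"
  using mixed_partials_commute[OF assms xi_in_I] by (auto simp: partial_rho_def)

lemma energy_and_trace_le_mono:
  assumes "energy_and_trace_le u B" "B \<le> B'"
  shows "energy_and_trace_le u B'"
proof -
  have le: "y \<le> B'" if "y \<le> B" for y using that assms(2) by simp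
  show ?thesis
    using assms(1) unfolding energy_and_trace_le_def by (elim conjE exE) (intro conjI exI ballI le; simp)
qed

lemma finite_initial_energy_test_data:
  assumes u: "smooth_on_strip I u" and data: "test_function (u xi)" "test_function (partial_x I u xi)"
  shows "finite_initial_energy u"
  unfolding finite_initial_energy_def
proof (intro allI impI)
  fix lam :: real
  obtain R1 where R1: "\<And>\<rho>. \<bar>\<rho>\<bar> > R1 \<Longrightarrow> u xi \<rho> = 0"
    using test_function_vanishes[OF data(1)] by blast
  obtain R2 where R2: "\<And>\<rho>. \<bar>\<rho>\<bar> > R2 \<Longrightarrow> partial_x I u xi \<rho> = 0"
    using test_function_vanishes[OF data(2)] by blast
  obtain R3 where R3: "\<And>\<rho>. \<bar>\<rho>\<bar> > R3 \<Longrightarrow> deriv (u xi) \<rho> = 0"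
    using test_function_vanishes[OF test_function_deriv[OF data(1)]] by blast
  define R where "R = max R1 (max R2 R3)"
  show "integrable lborel (dens lam u xi)"
  proof (rule integrable_continuous_vanishing_outside(1))
    show "continuous_on {-R..R} (dens lam u xi)" by (rule dens_continuous[OF u xi_in_I])
    show "dens lam u xi \<rho> = 0" if "\<rho> \<notin> {-R..R}" for \<rho>
    proof -
      have "\<bar>\<rho>\<bar> > R" using that by auto
      then have "\<bar>\<rho>\<bar> > R1" "\<bar>\<rho>\<bar> > R2" "\<bar>\<rho>\<bar> > R3" by (auto simp: R_def)
      then show ?thesis
        using R1 R2 R3 by (simp add: dens_def partial_rho_initial_data(1)[OF u])
    qed
  qed
qed

end

subsection \<open>Self-similar backgrounds\<close>

text \<open>Termwise differentiation of the series gives two-sided derivatives throughout \<bar>x -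
  a\<bar> < r, so also beyond the end point of a half-line, and a series for the derivative on the
  same interval.\<close>

lemma real_analytic_onE:
  assumes "real_analytic_on f S" "a \<in> S"
  obtains r c where "r > 0"
    "\<And>x. \<bar>x - a\<bar> < r \<Longrightarrow> (\<lambda>n. c n * (x - a) ^ n) sums f x"
    "\<And>x. \<bar>x - a\<bar> < r \<Longrightarrow> (f has_real_derivative deriv f x) (at x)"
    "\<And>x. \<bar>x - a\<bar> < r \<Longrightarrow> (\<lambda>n. diffs c n * (x - a) ^ n) sums deriv f x"
proof -
  from assms obtain r c where r: "r > 0" and
    s: "\<And>x. \<bar>x - a\<bar> < r \<Longrightarrow> (\<lambda>n. c n * (x - a) ^ n) sums f x"
    unfolding real_analytic_on_def by blast
  have sm: "summable (\<lambda>n. c n * z ^ n)" if "norm z < r" for z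
    using s[of "a + z"] that by (auto simp: sums_iff)
  have D: "(f has_real_derivative (\<Sum>n. diffs c n * (x - a) ^ n)) (at x)" if x: "\<bar>x - a\<bar> < r" for x
  proof -
    have "((\<lambda>z. \<Sum>n. c n * z ^ n) has_real_derivative (\<Sum>n. diffs c n * (x - a) ^ n)) (at (x - a))"
      by (rule termdiffs_strong'[of r]) (use sm x in auto)
    then have "((\<lambda>y. (\<Sum>n. c n * (y - a) ^ n)) has_real_derivative (\<Sum>n. diffs c n * (x - a) ^ n)) (at x)"
      using DERIV_shift[of _ _ x "- a"] by simp
    then show ?thesis
    proof (rule has_field_derivative_transform_within_open)
      show "open {x. \<bar>x - a\<bar> < r}" by (intro open_Collect_less continuous_intros)
    qed (use x s in \<open>auto simp: sums_iff\<close>)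
  qed
  show thesis
  proof (rule that[OF r s])
    fix x assume x: "\<bar>x - a\<bar> < r"
    show "(f has_real_derivative deriv f x) (at x)" using D[OF x] DERIV_imp_deriv[OF D[OF x]] by simp
    have "summable (\<lambda>n. diffs c n * (x - a) ^ n)"
      by (rule termdiff_converges[of _ r]) (use sm x in auto)
    then show "(\<lambda>n. diffs c n * (x - a) ^ n) sums deriv f x"
      using DERIV_imp_deriv[OF D[OF x]] by (simp add: summable_sums)
  qed
qed

lemma real_analytic_on_has_deriv:
  assumes "real_analytic_on f S" "a \<in> S"
  shows "(f has_real_derivative deriv f a) (at a)"
  using assms by (rule real_analytic_onE) auto

lemma real_analytic_on_deriv:
  assumes "real_analytic_on f S"
  shows "real_analytic_on (deriv f) S"
  unfolding real_analytic_on_def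
proof
  fix a assume "a \<in> S"
  from real_analytic_onE[OF assms this]
  show "\<exists>r>0. \<exists>c. \<forall>x. \<bar>x - a\<bar> < r \<longrightarrow> (\<lambda>n. c n * (x - a) ^ n) sums deriv f x"
    by metis
qed

lemma real_analytic_on_continuous_on:
  assumes "real_analytic_on f S" "T \<subseteq> S"
  shows "continuous_on T f"
  using real_analytic_on_has_deriv[OF assms(1)] assms(2)
  by (meson DERIV_isCont continuous_at_imp_continuous_on subsetD)

section \<open>The data energy\<close>

lemma data_density_integrable:
  assumes "test_function f" "test_function g"
  shows "integrable lborel (data_density G xi f g)"
proof -
  note f' = test_function_deriv[OF assms(1)]
  obtain R1 where R1: "\<And>\<rho>. \<bar>\<rho>\<bar> > R1 \<Longrightarrow> f \<rho> = 0"
    using test_function_vanishes[OF assms(1)] by blast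
  obtain R2 where R2: "\<And>\<rho>. \<bar>\<rho>\<bar> > R2 \<Longrightarrow> g \<rho> = 0"
    using test_function_vanishes[OF assms(2)] by blast
  obtain R3 where R3: "\<And>\<rho>. \<bar>\<rho>\<bar> > R3 \<Longrightarrow> deriv f \<rho> = 0"
    using test_function_vanishes[OF f'] by blast
  define R where "R = max R1 (max R2 R3)"
  have cont: "continuous_on S k" if "test_function k" for S and k :: "real \<Rightarrow> real"
    using test_function_differentiable[OF that] by (meson DERIV_isCont continuous_at_imp_continuous_on)
  show ?thesis
  proof (rule integrable_continuous_vanishing_outside(1))
    show "continuous_on {-R..R} (data_density G xi f g)"
      unfolding data_density_def by (intro continuous_intros cont assms f')
    show "data_density G xi f g \<rho> = 0" if "\<rho> \<notin> {-R..R}" for \<rho>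
    proof -
      have "\<bar>\<rho>\<bar> > R" using that by auto
      then have "\<bar>\<rho>\<bar> > R1" "\<bar>\<rho>\<bar> > R2" "\<bar>\<rho>\<bar> > R3" by (auto simp: R_def)
      then show ?thesis using R1 R2 R3 by (simp add: data_density_def)
    qed
  qed
qed

text \<open>The data energy contains the combination \<open>A * y + B * z\<close> instead of
  \<open>y\<close>. As \<open>A\<close> is nonzero at the initial slice, \<open>y\<close> is
  recovered from it and \<open>z\<close>, at the cost of dividing by \<open>- A\<close>.\<close>

lemma energy_le_data_density:
  fixes A B k H y z w :: real
  assumes "A < 0" "0 \<le> k" "0 \<le> H"
  shows "- A * y\<^sup>2 + k * z\<^sup>2 + H * w\<^sup>2
    \<le> (2 / - A + 2 * B\<^sup>2 / - A + k + H) * (w\<^sup>2 + (A * y + B * z)\<^sup>2 + z\<^sup>2)"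
proof -
  let ?s = "A * y + B * z"
  \<comment> \<open>The right side minus the left side is the square of
    \<open>A * y + 2 * (B * z)\<close>.\<close>
  have "(A * y)\<^sup>2 \<le> 2 * ?s\<^sup>2 + 2 * (B * z)\<^sup>2"
    using zero_le_power2[of "A * y + 2 * (B * z)"] by (simp add: power2_eq_square algebra_simps)
  then have "(A * y)\<^sup>2 / - A \<le> (2 * ?s\<^sup>2 + 2 * (B * z)\<^sup>2) / - A"
    by (rule divide_right_mono) (use assms in simp)
  moreover have "(A * y)\<^sup>2 / - A = - A * y\<^sup>2" using assms by (simp add: power2_eq_square field_simps)
  ultimately have 1: "- A * y\<^sup>2 \<le> 2 / - A * ?s\<^sup>2 + 2 * B\<^sup>2 / - A * z\<^sup>2"
    by (simp add: add_divide_distrib diff_divide_distrib power_mult_distrib)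
  have mono: "r * t \<le> r * (w\<^sup>2 + ?s\<^sup>2 + z\<^sup>2)" if "0 \<le> r" "t \<in> {w\<^sup>2, ?s\<^sup>2, z\<^sup>2}" for r t
    using that by (intro mult_left_mono) auto
  have nn: "0 \<le> 2 / - A" "0 \<le> 2 * B\<^sup>2 / - A" using assms by (auto simp: divide_nonneg_neg)
  show ?thesis
    using 1 mono[OF nn(1), of "?s\<^sup>2"] mono[OF nn(2), of "z\<^sup>2"] mono[OF assms(2), of "z\<^sup>2"]
      mono[OF assms(3), of "w\<^sup>2"]
    unfolding distrib_right[of _ _ "w\<^sup>2 + ?s\<^sup>2 + z\<^sup>2"] by auto
qed

section \<open>Coefficients of the wave equation on the background\<close>

text \<open>\<open>y * G y\<close> is 0 at the origin and continuous, so reaching 1 at or before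
  \<open>x\<close> would produce a root in \<open>(0, xc)\<close>.\<close>

lemma background_x_G_less_one:
  assumes bg: "self_similar_background G \<psi> xc" and x: "0 < x" "x < xc"
  shows "x * G x < 1"
proof (rule ccontr)
  assume "\<not> x * G x < 1"
  then have "1 \<le> x * G x" by simp
  moreover have "continuous_on {0..x} (\<lambda>y. y * G y)"
    using bg x unfolding self_similar_background_def
    by (intro continuous_intros real_analytic_on_continuous_on[of G "{..xc}"]) auto
  ultimately obtain y where y: "0 \<le> y" "y \<le> x" "y * G y = 1"
    using IVT'[of "\<lambda>y. y * G y" 0 1 x] x by auto
  then have "0 < y" by (cases "y = 0") auto
  then show False using y x bg unfolding self_similar_background_def by auto
qed

lemma background_has_derivs:
  assumes bg: "self_similar_background G \<psi> xc" and x: "x \<le> xc"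
  shows "(\<alpha> G has_real_derivative - 2 + 4 * x * G x + 2 * x\<^sup>2 * deriv G x) (at x)"
    and "(\<beta> G has_real_derivative - 2 * G x - 2 * x * deriv G x) (at x)"
    and "(\<gamma> G has_real_derivative 2 * deriv G x) (at x)"
proof -
  have G: "(G has_real_derivative deriv G x) (at x)"
    using bg x unfolding self_similar_background_def by (auto intro: real_analytic_on_has_deriv)
  show "(\<alpha> G has_real_derivative - 2 + 4 * x * G x + 2 * x\<^sup>2 * deriv G x) (at x)"
    unfolding \<alpha>_def[abs_def]
    by (rule derivative_eq_intros G refl)+ (simp add: power2_eq_square algebra_simps)
  show "(\<beta> G has_real_derivative - 2 * G x - 2 * x * deriv G x) (at x)"
    unfolding \<beta>_def[abs_def] by (rule derivative_eq_intros G refl)+ (simp add: algebra_simps)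
  show "(\<gamma> G has_real_derivative 2 * deriv G x) (at x)"
    unfolding \<gamma>_def[abs_def] by (rule derivative_eq_intros G refl)+ simp
qed

text \<open>This form displays the sign: for 0 \<le> \<kappa> < 1, \<open>G > 0\<close> and
  \<open>x * G' \<le> 0\<close> every summand is nonnegative.\<close>

lemma energy_potential_eq:
  assumes bg: "self_similar_background G \<psi> xc" and x: "x \<le> xc"
  shows "energy_potential G \<psi> l \<kappa> x =
    real l * (real l + 1) * exp (\<psi> x) + 2 * \<kappa> * ((1 - \<kappa>) * G x - x * deriv G x)"
  unfolding energy_potential_def DERIV_imp_deriv[OF background_has_derivs(2)[OF assms]] \<gamma>_def
  by (simp add: power2_eq_square algebra_simps)

text \<open>At \<open>xc\<close> one has \<open>x * G = 1\<close>, hence \<beta> = -1 and \<alpha>'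
  = 2 * (1 + xc * xc * G'). So positivity of \<alpha>' is the assumption on
  \<open>1 + xc\<^sup>2 * deriv G xc\<close>, and the bounds on \<kappa> give the sign of the
  potential and the dissipativity.\<close>

lemma background_degenerate_wave:
  assumes bg: "self_similar_background G \<psi> xc" and xi: "xi \<in> {0<..<xc}"
    and k0: "0 \<le> \<kappa>" and k1: "\<kappa> < min 1 ((1 - xc\<^sup>2 * deriv G xc) / 2)"
  shows "degenerate_wave xi xc (\<alpha> G) (deriv (\<alpha> G)) (\<beta> G) (\<gamma> G) (\<lambda>x. 2 * deriv G x)
    (energy_potential G \<psi> l \<kappa>)
    (\<lambda>x. real l * (real l + 1) * (exp (\<psi> x) * deriv \<psi> x)
       + 2 * \<kappa> * ((1 - \<kappa>) * deriv G x - (deriv G x + x * deriv (deriv G) x)))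
    (\<lambda>x. deriv (\<alpha> G) x + 2 * (1 - \<kappa>) * \<beta> G x) (\<lambda>x. deriv (\<beta> G) x + 2 * (1 - \<kappa>) * \<gamma> G x)"
proof -
  have an: "real_analytic_on G {..xc}" "real_analytic_on \<psi> {..xc}"
    and xcG: "xc * G xc = 1" and Gpos: "\<And>x. x \<le> xc \<Longrightarrow> G x > 0" and xc: "0 < xc"
    and G'neg: "\<And>x. 0 < x \<Longrightarrow> x < xc \<Longrightarrow> deriv G x < 0" "deriv G xc < 0"
    and G'xc: "1 + xc\<^sup>2 * deriv G xc > 0"
    using bg unfolding self_similar_background_def by auto
  have sub: "{xi..xc} \<subseteq> {..xc}" by auto
  have xi': "0 < xi" "xi < xc" using xi by auto
  note an' = real_analytic_on_deriv[OF an(1)]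
  have cG: "continuous_on {xi..xc} G" "continuous_on {xi..xc} (deriv G)"
      "continuous_on {xi..xc} (deriv (deriv G))"
    and c\<psi>: "continuous_on {xi..xc} \<psi>" "continuous_on {xi..xc} (deriv \<psi>)"
    by (rule real_analytic_on_continuous_on[OF _ sub], intro real_analytic_on_deriv an)+
  have \<alpha>': "deriv (\<alpha> G) x = - 2 + 4 * x * G x + 2 * x\<^sup>2 * deriv G x" if "x \<le> xc" for x
    by (rule DERIV_imp_deriv[OF background_has_derivs(1)[OF bg that]])
  have \<beta>': "deriv (\<beta> G) x = - 2 * G x - 2 * x * deriv G x" if "x \<le> xc" for x
    by (rule DERIV_imp_deriv[OF background_has_derivs(2)[OF bg that]])
  have "continuous_on {xi..xc} (\<lambda>x. - 2 + 4 * x * G x + 2 * x\<^sup>2 * deriv G x)"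
    by (intro continuous_intros cG)
  then have c\<alpha>': "continuous_on {xi..xc} (deriv (\<alpha> G))"
    by (subst continuous_on_cong[OF refl \<alpha>']) auto
  have "continuous_on {xi..xc} (\<lambda>x. - 2 * G x - 2 * x * deriv G x)"
    by (intro continuous_intros cG)
  then have c\<beta>': "continuous_on {xi..xc} (deriv (\<beta> G))"
    by (subst continuous_on_cong[OF refl \<beta>']) auto
  have c\<beta>: "continuous_on {xi..xc} (\<beta> G)" unfolding \<beta>_def[abs_def] by (intro continuous_intros cG)
  have c\<gamma>: "continuous_on {xi..xc} (\<gamma> G)" unfolding \<gamma>_def[abs_def] by (intro continuous_intros cG)
  have bxc: "\<beta> G xc = - 1" using xcG by (simp add: \<beta>_def)
  have axc: "deriv (\<alpha> G) xc = 2 + 2 * xc\<^sup>2 * deriv G xc"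
    using \<alpha>'[of xc] xcG by simp
  show ?thesis
  proof
    show "xi < xc" by (rule xi'(2))
  next
    fix x assume "x \<in> {xi..xc}"
    then have x: "x \<le> xc" "0 < x" using xi' by auto
    show "(\<alpha> G has_real_derivative deriv (\<alpha> G) x) (at x within {xi..xc})"
      unfolding \<alpha>'[OF x(1)] by (rule has_field_derivative_at_within[OF background_has_derivs(1)[OF bg x(1)]])
    show "(\<gamma> G has_real_derivative 2 * deriv G x) (at x within {xi..xc})"
      by (rule has_field_derivative_at_within[OF background_has_derivs(3)[OF bg x(1)]])
    show "0 < \<gamma> G x" using Gpos[OF x(1)] by (simp add: \<gamma>_def)
    have G'le: "deriv G x \<le> 0" using G'neg x by (cases "x = xc") (auto intro: less_imp_le)
    have "0 \<le> (1 - \<kappa>) * G x - x * deriv G x"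
    proof -
      have "0 \<le> (1 - \<kappa>) * G x" using k1 Gpos[OF x(1)] by simp
      moreover have "x * deriv G x \<le> 0" using x G'le by (simp add: mult_nonneg_nonpos)
      ultimately show ?thesis by linarith
    qed
    then show "0 \<le> energy_potential G \<psi> l \<kappa> x"
      unfolding energy_potential_eq[OF bg x(1)] using k0 by simp
  next
    fix x assume xI: "x \<in> {xi..xc}"
    then have x: "x \<le> xc" by simp
    have d: "(G has_real_derivative deriv G x) (at x within {xi..xc})"
      "(deriv G has_real_derivative deriv (deriv G) x) (at x within {xi..xc})"
      "(\<psi> has_real_derivative deriv \<psi> x) (at x within {xi..xc})"
      by (rule has_field_derivative_at_within, rule real_analytic_on_has_deriv, rule an an', simp add: x)+
    have "((\<lambda>x. real l * (real l + 1) * exp (\<psi> x) + 2 * \<kappa> * ((1 - \<kappa>) * G x - x * deriv G x))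
      has_real_derivative real l * (real l + 1) * (exp (\<psi> x) * deriv \<psi> x)
       + 2 * \<kappa> * ((1 - \<kappa>) * deriv G x - (deriv G x + x * deriv (deriv G) x))) (at x within {xi..xc})"
      by (rule derivative_eq_intros d refl)+ (simp add: algebra_simps)
    then show "(energy_potential G \<psi> l \<kappa> has_real_derivative real l * (real l + 1) * (exp (\<psi> x) * deriv \<psi> x)
       + 2 * \<kappa> * ((1 - \<kappa>) * deriv G x - (deriv G x + x * deriv (deriv G) x))) (at x within {xi..xc})"
      by (rule has_field_derivative_transform_within[OF _ zero_less_one xI])
        (simp add: energy_potential_eq[OF bg])
  next
    show "continuous_on {xi..xc} (\<lambda>x. 2 * deriv G x)" by (intro continuous_intros cG)
    show "continuous_on {xi..xc} (\<lambda>x. real l * (real l + 1) * (exp (\<psi> x) * deriv \<psi> x)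
       + 2 * \<kappa> * ((1 - \<kappa>) * deriv G x - (deriv G x + x * deriv (deriv G) x)))"
      by (intro continuous_intros cG c\<psi>)
    show "continuous_on {xi..xc} (\<lambda>x. deriv (\<alpha> G) x + 2 * (1 - \<kappa>) * \<beta> G x)"
      "continuous_on {xi..xc} (\<lambda>x. deriv (\<beta> G) x + 2 * (1 - \<kappa>) * \<gamma> G x)"
      by (intro continuous_intros c\<alpha>' c\<beta>' c\<beta> c\<gamma>)+
  next
    fix x assume x: "x \<in> {xi..<xc}"
    then have "x * G x < 1" using background_x_G_less_one[OF bg] xi' by auto
    then show "\<alpha> G x < 0" using mult_pos_pos[of x "1 - x * G x"] x xi' by (simp add: \<alpha>_def)
  next
    show "\<alpha> G xc = 0" using xcG by (simp add: \<alpha>_def)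
    show "0 < deriv (\<alpha> G) xc" unfolding axc using G'xc by simp
    \<comment> \<open>With the values at \<open>xc\<close> this reads \<alpha>' < 4 * (1 -
      \<kappa>), which is the second upper bound on \<kappa>.\<close>
    show "2 * (deriv (\<alpha> G) xc + 2 * (1 - \<kappa>) * \<beta> G xc) < deriv (\<alpha> G) xc"
    proof -
      have "2 * \<kappa> < 1 - xc\<^sup>2 * deriv G xc" using k1 by simp
      then show ?thesis unfolding axc bxc by (simp add: algebra_simps)
    qed
  qed (rule c\<alpha>' c\<beta>)+
qed

section \<open>The energy estimate up to the Cauchy horizon\<close>

theorem theorem3:
  fixes G \<psi> :: "real \<Rightarrow> real" and xc xi \<kappa> :: real and l :: nat
  assumes "self_similar_background G \<psi> xc"
    and "xi \<in> {0<..<xc}"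
    and "0 \<le> \<kappa>" and "\<kappa> < min 1 ((1 - xc\<^sup>2 * deriv G xc) / 2)"
  shows "\<exists>C1>0. \<exists>C2>0. \<forall>f g u.
    test_function f \<longrightarrow> test_function g \<longrightarrow> wave_solution G \<psi> l \<kappa> xc xi f g u \<longrightarrow>
      integrable lborel (data_density G xi f g) \<and>
      (\<forall>x\<in>{xi..<xc}.
         integrable lborel (energy_density G \<psi> l \<kappa> {xi..<xc} u x) \<and>
         energy G \<psi> l \<kappa> {xi..<xc} u x \<le> C1 * data_energy G xi f g) \<and>
      (\<exists>Ec. (energy G \<psi> l \<kappa> {xi..<xc} u \<longlongrightarrow> Ec) (at_left xc) \<and>
         Ec \<le> C1 * data_energy G xi f g) \<and>
      (\<exists>uc uc_rho.
         (\<forall>\<rho>. ((\<lambda>x. u x \<rho>) \<longlongrightarrow> uc \<rho>) (at_left xc)) \<and>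
         (\<forall>\<rho>. ((\<lambda>x. partial_rho u x \<rho>) \<longlongrightarrow> uc_rho \<rho>) (at_left xc)) \<and>
         (\<forall>\<rho>. (uc has_real_derivative uc_rho \<rho>) (at \<rho>)) \<and>
         integrable lborel (\<lambda>\<rho>. (uc \<rho>)\<^sup>2 + (uc_rho \<rho>)\<^sup>2) \<and>
         (LINT \<rho>|lborel. (uc \<rho>)\<^sup>2 + (uc_rho \<rho>)\<^sup>2) \<le> C2 * data_energy G xi f g)"
    (is "\<exists>C1>0. \<exists>C2>0. \<forall>f g u. _ f \<longrightarrow> _ g \<longrightarrow> _ f g u \<longrightarrow> ?P C1 C2 f g u")
proof -
  interpret degenerate_wave xi xc "\<alpha> G" "deriv (\<alpha> G)" "\<beta> G" "\<gamma> G" "\<lambda>x. 2 * deriv G x"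
    "energy_potential G \<psi> l \<kappa>"
    "\<lambda>x. real l * (real l + 1) * (exp (\<psi> x) * deriv \<psi> x)
       + 2 * \<kappa> * ((1 - \<kappa>) * deriv G x - (deriv G x + x * deriv (deriv G) x))"
    "\<lambda>x. deriv (\<alpha> G) x + 2 * (1 - \<kappa>) * \<beta> G x" "\<lambda>x. deriv (\<beta> G) x + 2 * (1 - \<kappa>) * \<gamma> G x"
    by (rule background_degenerate_wave[OF assms])
  have xi': "xi \<in> {xi..xc}" using xi_less_xc by simp
  obtain C where C: "C > 0"
    "\<forall>u. solves u \<longrightarrow> finite_initial_energy u \<longrightarrow> finite_initial_energy (partial_rho u) \<longrightarrow>
      finite_initial_energy (partial_rho (partial_rho u)) \<longrightarrow>
      energy_and_trace_le u (C * integral\<^sup>L lborel (dens 1 u xi))"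
    by (rule energy_and_trace_bound)
  have axi: "\<alpha> G xi < 0" and cxi: "0 \<le> \<gamma> G xi" and hxi: "0 \<le> energy_potential G \<psi> l \<kappa> xi + 1"
    using a_neg[OF xi_in_I] c_pos[OF xi'] h_nonneg[OF xi'] by simp_all
  \<comment> \<open>The factor of \<open>energy_le_data_density\<close> at \<open>xi\<close>; the
    last summand is the zeroth-order coefficient of the density with \<open>lam = 1\<close>.\<close>
  define C0 where "C0 = 2 / - \<alpha> G xi + 2 * (\<beta> G xi)\<^sup>2 / - \<alpha> G xi + \<gamma> G xi + (energy_potential G \<psi> l \<kappa> xi + 1)"
  have C0: "C0 > 0"
  proof -
    have "2 / - \<alpha> G xi > 0" "2 * (\<beta> G xi)\<^sup>2 / - \<alpha> G xi \<ge> 0" using axi by (auto simp: divide_nonneg_neg divide_pos_neg)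
    then show ?thesis unfolding C0_def using cxi hxi by linarith
  qed
  \<comment> \<open>The product \<open>C * C0\<close> serves for both constants: \<open>C\<close>
    measures the evolution and \<open>C0\<close> the comparison of the initial energy with the
    data.\<close>
  have main: "?P (C * C0) (C * C0) f g u"
    if f: "test_function f" and g: "test_function g" and sol: "wave_solution G \<psi> l \<kappa> xc xi f g u" for f g u
  proof -
    have uS: "smooth_on_strip {xi..<xc} u" and uf: "u xi = f" and ug: "partial_x {xi..<xc} u xi = g"
      using sol unfolding wave_solution_def by auto
    have u: "solves u"
      unfolding solves_def
    proof (intro conjI uS ballI allI)
      fix x \<rho> assume "x \<in> {xi..<xc}"
      then have "wave_operator G \<psi> l \<kappa> {xi..<xc} u x \<rho> = 0"
        using sol unfolding wave_solution_def by blast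
      \<comment> \<open>The zeroth-order coefficient of the wave operator is minus the energy
        potential, so the abstract equation is the given one.\<close>
      then show "\<alpha> G x * partial_x {xi..<xc} (partial_x {xi..<xc} u) x \<rho>
        + 2 * \<beta> G x * partial_rho (partial_x {xi..<xc} u) x \<rho>
        + \<gamma> G x * partial_rho (partial_rho u) x \<rho>
        + (deriv (\<alpha> G) x + 2 * (1 - \<kappa>) * \<beta> G x) * partial_x {xi..<xc} u x \<rho>
        + (deriv (\<beta> G) x + 2 * (1 - \<kappa>) * \<gamma> G x) * partial_rho u x \<rho>
        - energy_potential G \<psi> l \<kappa> x * u x \<rho> = 0"
        unfolding wave_operator_def energy_potential_def by (simp add: algebra_simps)
    qed
    note vS = smooth_on_strip_partial_rho[OF uS]
    \<comment> \<open>The three solutions have the data \<open>f\<close>, \<open>g\<close>, their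
      first derivatives and their second derivatives, all of which are test functions.\<close>
    have fin: "finite_initial_energy u" "finite_initial_energy (partial_rho u)"
      "finite_initial_energy (partial_rho (partial_rho u))"
      by (intro finite_initial_energy_test_data smooth_on_strip_partial_rho uS;
          simp add: partial_rho_initial_data[OF uS] partial_rho_initial_data[OF vS] uf ug f g test_function_deriv)+
    have dd: "integrable lborel (data_density G xi f g)" by (rule data_density_integrable[OF f g])
    have le: "dens 1 u xi \<rho> \<le> C0 * data_density G xi f g \<rho>" for \<rho>
      using energy_le_data_density[OF axi cxi hxi, of "g \<rho>" "deriv f \<rho>" "f \<rho>" "\<beta> G xi"]
      unfolding dens_def data_density_def C0_def by (simp only: uf ug partial_rho_initial_data(1)[OF uS])
    have "integral\<^sup>L lborel (dens 1 u xi) \<le> C0 * data_energy G xi f g"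
      unfolding data_energy_def
      using integral_mono[OF dens_integrable[OF u fin(1) zero_less_one xi_in_I] integrable_mult_right[OF dd, of C0] le]
      by simp
    then have E: "C * integral\<^sup>L lborel (dens 1 u xi) \<le> C * C0 * data_energy G xi f g"
      using C(1) by (simp add: mult.assoc)
    have ed: "energy_density G \<psi> l \<kappa> {xi..<xc} u x = dens 0 u x" for x
      by (simp add: energy_density_def dens_def fun_eq_iff)
    have en: "energy G \<psi> l \<kappa> {xi..<xc} u = (\<lambda>x. integral\<^sup>L lborel (dens 0 u x))"
      by (simp add: energy_def ed fun_eq_iff)
    have "energy_and_trace_le u (C * integral\<^sup>L lborel (dens 1 u xi))" using C(2) u fin by blast
    then have "energy_and_trace_le u (C * C0 * data_energy G xi f g)"
      by (rule energy_and_trace_le_mono[OF _ E])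
    then show ?thesis unfolding ed en energy_and_trace_le_def using dd by blast
  qed
  have "C * C0 > 0" using C(1) C0 by simp
  with main show ?thesis by blast
qed

end
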